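(* Let $P\in\mathbb C[x_1,x_2,x_3]$ be any polynomial from the following list (with the indicated parameters): (PV) $x_1x_2x_3+x_1^2+x_2^2-(s_1+s_2s_3)x_1-(s_2+s_1s_3)x_2-s_3x_3+(s_3^2+s_1s_2s_3+1)$, $s_1,s_2\in\mathbb C$, $s_3\in\mathbb C^*$; (PV$^{\deg}$) $x_1x_2x_3+x_1^2+x_2^2+s_1x_1+s_2x_2+1$, $s_1,s_2\in\mathbb C$; (PIII(D6)) $x_1x_2x_3+x_1^2+x_2^2+(1+\alpha\beta)x_1+(\alpha+\beta)x_2+\alpha\beta$, $\alpha,\beta\in\mathbb C^*$; (PIII(D7)) $x_1x_2x_3+x_1^2+x_2^2+\alpha x_1+x_2$, $\alpha\in\mathbb C^*$; (PIII(D8)) $x_1x_2x_3+x_1^2-x_2^2-x_1$; (PIV) $x_1x_2x_3+x_1^2-(s_2^2+s_1s_2)x_1-s_2^2x_2-s_2^2x_3+(s_2^2+s_1s_2^3)$, $s_1\in\mathbb C$, $s_2\in\mathbb C^*$; (PII$^{FN}$) $x_1x_2x_3+x_1-x_2+x_3+s$, $s\in\mathbb C$; (PII) $x_1x_2x_3-x_1-\alpha x_2-x_3+\alpha+1$, $\alpha\in\mathbb C^*$; (PI) $x_1x_2x_3+x_1+x_2+1$. Let $S=\{P=0\}\subset\mathbb C^3$, with symplectic form $\Omega=\frac{dx_1\wedge dx_2}{P_{x_3}}=\frac{dx_2\wedge dx_3}{P_{x_1}}=\frac{dx_3\wedge dx_1}{P_{x_2}}$ (where $P_{x_i}=\partial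 P/\partial x_i$), and foliations $\mathcal F_i=\ker(dx_i|_S)$, $i=1,2,3$. Then: (1) the $3$-web $(\mathcal F_1,\mathcal F_2,\mathcal F_3)$ is not (locally) parallelizable, except in the cases PII$^{FN}$, PII, PI; (2) for at least one pair $\{i,j\}\subset\{1,2,3\}$, the Hess connection of the bi-Lagrangian manifold $(S,\Omega,\mathcal F_i,\mathcal F_j)$ is not flat.
   Context: A regular $3$-web is a triple of pairwise transversal holomorphic foliations on a complex surface; it is locally parallelizable if in suitable local holomorphic coordinates each foliation is given by a constant $1$-form (parallel lines). Everything is considered on the open subset of smooth points of $S$ where the relevant foliations are pairwise transversal. The Hess connection of a bi-Lagrangian surface $(M,\omega,\mathcal F,\mathcal G)$ (transversal foliations by curves) is the unique torsion-free affine connection $\nabla$ with $X\cdot\omega(Y,Z)=\omega(\nabla_XY,Z)+\omega(Y,\nabla_XZ)$ and preserving both foliations (i.e. $\nabla_XY$ tangent to a foliation whenever $Y$ is); it is flat if its curvature tensor vanishes identically. *)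

theory Defs
  imports "HOL-Analysis.Analysis"
begin

type_synonym pt3 = "complex \<times> complex \<times> complex"
type_synonym pt2 = "complex \<times> complex"

definition coord :: "nat \<Rightarrow> pt3 \<Rightarrow> complex" where
  "coord i x = (if i = 1 then fst x else if i = 2 then fst (snd x) else snd (snd x))"

definition upd3 :: "nat \<Rightarrow> complex \<Rightarrow> pt3 \<Rightarrow> pt3" where
  "upd3 i t x = (if i = 1 then (t, fst (snd x), snd (snd x))
                 else if i = 2 then (fst x, t, snd (snd x))
                 else (fst x, fst (snd x), t))"

definition pdP :: "(pt3 \<Rightarrow> complex) \<Rightarrow> nat \<Rightarrow> pt3 \<Rightarrow> complex" where
  "pdP P i x = deriv (\<lambda>t. P (upd3 i t x)) (coord i x)"

definition surf :: "(pt3 \<Rightarrow> complex) \<Rightarrow> pt3 set" where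
  "surf P = {x. P x = 0}"

text \<open>Open subset of S where F_1, F_2, F_3 are pairwise transversal (F_i, F_j are
  transversal at a point of S exactly when P_{x_k} does not vanish there, {i,j,k}={1,2,3}).\<close>
definition web_region :: "(pt3 \<Rightarrow> complex) \<Rightarrow> pt3 set" where
  "web_region P = {x \<in> surf P. \<forall>k\<in>{1,2,3}. pdP P k x \<noteq> 0}"

text \<open>Open subset of S where F_i and F_j are transversal.\<close>
definition pair_region :: "(pt3 \<Rightarrow> complex) \<Rightarrow> nat \<Rightarrow> nat \<Rightarrow> pt3 set" where
  "pair_region P i j = {x \<in> surf P. \<forall>k\<in>{1,2,3}. k \<noteq> i \<longrightarrow> k \<noteq> j \<longrightarrow> pdP P k x \<noteq> 0}"

definition Omega :: "(pt3 \<Rightarrow> complex) \<Rightarrow> pt3 \<Rightarrow> pt3 \<Rightarrow> pt3 \<Rightarrow> complex" where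
  "Omega P x u v =
     (if pdP P 3 x \<noteq> 0 then (coord 1 u * coord 2 v - coord 2 u * coord 1 v) / pdP P 3 x
      else if pdP P 1 x \<noteq> 0 then (coord 2 u * coord 3 v - coord 3 u * coord 2 v) / pdP P 1 x
      else (coord 3 u * coord 1 v - coord 1 u * coord 3 v) / pdP P 2 x)"

definition holo2 :: "(pt2 \<Rightarrow> complex) \<Rightarrow> pt2 set \<Rightarrow> bool" where
  "holo2 f V \<longleftrightarrow> open V \<and>
     (\<forall>y\<in>V. \<exists>a b. (f has_derivative (\<lambda>v. a * fst v + b * snd v)) (at y))"

definition d2 :: "nat \<Rightarrow> (pt2 \<Rightarrow> complex) \<Rightarrow> pt2 \<Rightarrow> complex" where
  "d2 a f y = (if a = 1 then deriv (\<lambda>t. f (t, snd y)) (fst y)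
               else deriv (\<lambda>t. f (fst y, t)) (snd y))"

definition dvec :: "nat \<Rightarrow> (pt2 \<Rightarrow> pt3) \<Rightarrow> pt2 \<Rightarrow> pt3" where
  "dvec a phi y = (d2 a (\<lambda>z. coord 1 (phi z)) y, d2 a (\<lambda>z. coord 2 (phi z)) y,
                   d2 a (\<lambda>z. coord 3 (phi z)) y)"

text \<open>A local holomorphic coordinate system on the (open) subset U of S around p,
  given by its holomorphic parametrisation phi : V -> U (a holomorphic immersion which is a
  homeomorphism of V onto an open neighbourhood of p in U).\<close>
definition hol_chart :: "pt3 set \<Rightarrow> (pt2 \<Rightarrow> pt3) \<Rightarrow> pt2 set \<Rightarrow> pt3 \<Rightarrow> bool" where
  "hol_chart U phi V p \<longleftrightarrow>
     open V \<and> (\<forall>i\<in>{1,2,3}. holo2 (\<lambda>y. coord i (phi y)) V) \<and>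
     phi ` V \<subseteq> U \<and> p \<in> phi ` V \<and> openin (top_of_set U) (phi ` V) \<and>
     inj_on phi V \<and> continuous_on (phi ` V) (the_inv_into V phi) \<and>
     (\<forall>y\<in>V. \<forall>c1 c2. 
        (\<forall>i\<in>{1,2,3}. c1 * coord i (dvec 1 phi y) + c2 * coord i (dvec 2 phi y) = 0)
        \<longrightarrow> c1 = 0 \<and> c2 = 0)"

definition web_locally_parallelizable :: "(pt3 \<Rightarrow> complex) \<Rightarrow> bool" where
  "web_locally_parallelizable P \<longleftrightarrow>
     (\<forall>p\<in>web_region P. \<exists>phi V. hol_chart (web_region P) phi V p \<and>
        (\<forall>i\<in>{1,2,3}. \<exists>c1 c2. (c1, c2) \<noteq> (0, 0) \<and>
           (\<forall>y\<in>V. \<forall>v1 v2.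
              d2 1 (\<lambda>z. coord i (phi z)) y * v1 + d2 2 (\<lambda>z. coord i (phi z)) y * v2 = 0
              \<longleftrightarrow> c1 * v1 + c2 * v2 = 0)))"

text \<open>Affine connection in the chart: nabla_{e_a} e_b = sum_c Gam c a b e_c.\<close>

definition cov_deriv :: "(nat \<Rightarrow> nat \<Rightarrow> nat \<Rightarrow> pt2 \<Rightarrow> complex) \<Rightarrow> nat \<Rightarrow>
    (nat \<Rightarrow> pt2 \<Rightarrow> complex) \<Rightarrow> nat \<Rightarrow> pt2 \<Rightarrow> complex" where
  "cov_deriv Gam a Y c y = d2 a (Y c) y + (\<Sum>b\<in>{1,2}. Gam c a b y * Y b y)"

definition tangent_fol :: "(pt2 \<Rightarrow> pt3) \<Rightarrow> nat \<Rightarrow> pt2 \<Rightarrow> complex \<Rightarrow> complex \<Rightarrow> bool" where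
  "tangent_fol phi i y v1 v2 \<longleftrightarrow>
     d2 1 (\<lambda>z. coord i (phi z)) y * v1 + d2 2 (\<lambda>z. coord i (phi z)) y * v2 = 0"

definition is_hess_conn :: "(pt3 \<Rightarrow> complex) \<Rightarrow> nat \<Rightarrow> nat \<Rightarrow> (pt2 \<Rightarrow> pt3) \<Rightarrow> pt2 set \<Rightarrow>
    (nat \<Rightarrow> nat \<Rightarrow> nat \<Rightarrow> pt2 \<Rightarrow> complex) \<Rightarrow> bool" where
  "is_hess_conn P i j phi V Gam \<longleftrightarrow>
     (\<forall>a\<in>{1,2}. \<forall>b\<in>{1,2}. \<forall>c\<in>{1,2}. holo2 (Gam c a b) V) \<and>
     \<comment> \<open>torsion free\<close>
     (\<forall>a\<in>{1,2}. \<forall>b\<in>{1,2}. \<forall>c\<in>{1,2}. \<forall>y\<in>V. Gam c a b y = Gam c b a y) \<and>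
     \<comment> \<open>X.omega(Y,Z) = omega(nabla_X Y, Z) + omega(Y, nabla_X Z), on coordinate fields\<close>
     (\<forall>a\<in>{1,2}. \<forall>b\<in>{1,2}. \<forall>c\<in>{1,2}. \<forall>y\<in>V.
        d2 a (\<lambda>z. Omega P (phi z) (dvec b phi z) (dvec c phi z)) y =
          (\<Sum>e\<in>{1,2}. Gam e a b y * Omega P (phi y) (dvec e phi y) (dvec c phi y)) +
          (\<Sum>e\<in>{1,2}. Gam e a c y * Omega P (phi y) (dvec b phi y) (dvec e phi y))) \<and>
     \<comment> \<open>preserves F_i and F_j\<close>
     (\<forall>k\<in>{i,j}. \<forall>Y. holo2 (Y 1) V \<and> holo2 (Y 2) V \<and>
        (\<forall>y\<in>V. tangent_fol phi k y (Y 1 y) (Y 2 y)) \<longrightarrow>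
        (\<forall>a\<in>{1,2}. \<forall>y\<in>V. tangent_fol phi k y (cov_deriv Gam a Y 1 y) (cov_deriv Gam a Y 2 y)))"

text \<open>Curvature: component d of R(e_a,e_b)e_c = nabla_a nabla_b e_c - nabla_b nabla_a e_c.\<close>
definition curv :: "(nat \<Rightarrow> nat \<Rightarrow> nat \<Rightarrow> pt2 \<Rightarrow> complex) \<Rightarrow> nat \<Rightarrow> nat \<Rightarrow> nat \<Rightarrow> nat \<Rightarrow> pt2 \<Rightarrow> complex" where
  "curv Gam d c a b y =
     d2 a (Gam d b c) y - d2 b (Gam d a c) y +
     (\<Sum>e\<in>{1,2}. Gam e b c y * Gam d a e y - Gam e a c y * Gam d b e y)"

definition hess_flat :: "(pt3 \<Rightarrow> complex) \<Rightarrow> nat \<Rightarrow> nat \<Rightarrow> bool" where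
  "hess_flat P i j \<longleftrightarrow>
     (\<forall>p\<in>pair_region P i j. \<exists>phi V Gam. hol_chart (pair_region P i j) phi V p \<and>
        is_hess_conn P i j phi V Gam \<and>
        (\<forall>y\<in>V. \<forall>a\<in>{1,2}. \<forall>b\<in>{1,2}. \<forall>c\<in>{1,2}. \<forall>d\<in>{1,2}. curv Gam d c a b y = 0))"

definition nonexc_cubics :: "(pt3 \<Rightarrow> complex) set" where
  "nonexc_cubics =
    {P. \<exists>s1 s2 s3. s3 \<noteq> 0 \<and> P = (\<lambda>(x1,x2,x3). x1 * x2 * x3 + x1^2 + x2^2 - (s1 + s2 * s3)*x1
          - (s2 + s1 * s3)*x2 - s3 * x3 + (s3^2 + s1 * s2 * s3 + 1))} \<union>
    {P. \<exists>s1 s2. P = (\<lambda>(x1,x2,x3). x1 * x2 * x3 + x1^2 + x2^2 + s1 * x1 + s2 * x2 + 1)} \<union>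
    {P. \<exists>\<alpha> \<beta>. \<alpha> \<noteq> 0 \<and> \<beta> \<noteq> 0 \<and> P = (\<lambda>(x1,x2,x3). x1 * x2 * x3 + x1^2 + x2^2 + (1 + \<alpha>*\<beta>)*x1
          + (\<alpha> + \<beta>)*x2 + \<alpha>*\<beta>)} \<union>
    {P. \<exists>\<alpha>. \<alpha> \<noteq> 0 \<and> P = (\<lambda>(x1,x2,x3). x1 * x2 * x3 + x1^2 + x2^2 + \<alpha>*x1 + x2)} \<union>
    {(\<lambda>(x1,x2,x3). x1 * x2 * x3 + x1^2 - x2^2 - x1)} \<union>
    {P. \<exists>s1 s2. s2 \<noteq> 0 \<and> P = (\<lambda>(x1,x2,x3). x1 * x2 * x3 + x1^2 - (s2^2 + s1 * s2)*x1 - s2^2 * x2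
          - s2^2 * x3 + (s2^2 + s1 * s2^3))}"

definition exc_cubics :: "(pt3 \<Rightarrow> complex) set" where
  "exc_cubics =
    {P. \<exists>s. P = (\<lambda>(x1,x2,x3). x1 * x2 * x3 + x1 - x2 + x3 + s)} \<union>
    {P. \<exists>\<alpha>. \<alpha> \<noteq> 0 \<and> P = (\<lambda>(x1,x2,x3). x1 * x2 * x3 - x1 - \<alpha>*x2 - x3 + \<alpha> + 1)} \<union>
    {(\<lambda>(x1,x2,x3). x1 * x2 * x3 + x1 + x2 + 1)}"

end

theory Submission
  imports Defs "HOL-Complex_Analysis.Conformal_Mappings"
begin

text \<open>
  Let f and g be the restrictions of two coordinate functions. A torsion-free connection
  preserving the foliations they define satisfies \<open>\<nabla> df = s df \<otimes> df\<close> and \<open>\<nabla> dg = t dg \<otimes> dg\<close>, and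
  if it is flat then \<open>s df\<close> is closed, so s is a function of f alone. For the Hess connection the
  area form \<open>df \<and> dg / L\<close> is parallel, whence \<open>s df + t dg = d log L\<close>, and flatness forces the
  mixed derivative of log L with respect to f and g to vanish. For a parallelizable web the flat
  connection of the linearizing chart gives \<open>s df - t dg = d log Q\<close>, where Q is the quotient of
  the partial derivatives of the cubic in the two variables, and the mixed derivative of log Q
  vanishes. In both cases this is a polynomial identity, refuted by a nonzero coefficient. When
  the cubic has no square terms, the third foliation is the kernel of a form \<open>df / r(f) + dg /
  q(g)\<close>, and its two summands are differentials of parallelizing coordinates.
\<close>

declare One_nat_def [simp del]

section \<open>Holomorphic functions of two variables\<close>

definition has_d2 :: "(pt2 \<Rightarrow> complex) \<Rightarrow> complex \<Rightarrow> complex \<Rightarrow> pt2 \<Rightarrow> bool" where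
  "has_d2 f a b y \<longleftrightarrow> (f has_derivative (\<lambda>v. a * fst v + b * snd v)) (at y)"

lemma has_d2_partials:
  assumes "has_d2 f a b y"
  shows "((\<lambda>t. f (t, snd y)) has_field_derivative a) (at (fst y))"
    and "((\<lambda>t. f (fst y, t)) has_field_derivative b) (at (snd y))"
proof -
  have f: "(f has_derivative (\<lambda>v. a * fst v + b * snd v)) (at (fst y, snd y))"
    using assms by (simp add: has_d2_def)
  have "((\<lambda>t. (t, snd y)) has_derivative (\<lambda>h. (h, 0))) (at (fst y))"
    by (auto intro!: derivative_eq_intros)
  from has_derivative_compose[OF this f]
  show "((\<lambda>t. f (t, snd y)) has_field_derivative a) (at (fst y))"
    by (simp add: has_field_derivative_def)
  have "((\<lambda>t. (fst y, t)) has_derivative (\<lambda>h. (0, h))) (at (snd y))"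
    by (auto intro!: derivative_eq_intros)
  from has_derivative_compose[OF this f]
  show "((\<lambda>t. f (fst y, t)) has_field_derivative b) (at (snd y))"
    by (simp add: has_field_derivative_def)
qed

lemma d2_cases: "d2 a = d2 1 \<or> d2 a = d2 2"
  by (simp add: d2_def fun_eq_iff)

lemma has_d2_imp_d2:
  assumes "has_d2 f a b y"
  shows "d2 1 f y = a" "d2 2 f y = b"
  using has_d2_partials[OF assms] by (auto simp: d2_def DERIV_imp_deriv)

lemma has_d2_eq_rhs: "has_d2 f a b y \<Longrightarrow> a = a' \<Longrightarrow> b = b' \<Longrightarrow> has_d2 f a' b' y"
  by simp

lemma has_d2_const: "has_d2 (\<lambda>y. k) 0 0 y"
  by (simp add: has_d2_def)

lemma has_d2_fst: "has_d2 fst 1 0 y"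
  by (simp add: has_d2_def has_derivative_fst)

lemma has_d2_snd: "has_d2 snd 0 1 y"
  by (simp add: has_d2_def has_derivative_snd)

lemma has_d2_add:
  "has_d2 f a b y \<Longrightarrow> has_d2 g c d y \<Longrightarrow> has_d2 (\<lambda>y. f y + g y) (a + c) (b + d) y"
  unfolding has_d2_def
  by (drule (1) has_derivative_add) (simp add: algebra_simps)

lemma has_d2_uminus: "has_d2 f a b y \<Longrightarrow> has_d2 (\<lambda>y. - f y) (- a) (- b) y"
  unfolding has_d2_def
  by (drule has_derivative_minus) (simp add: algebra_simps)

lemma has_d2_diff:
  "has_d2 f a b y \<Longrightarrow> has_d2 g c d y \<Longrightarrow> has_d2 (\<lambda>y. f y - g y) (a - c) (b - d) y"
  unfolding has_d2_def
  by (drule (1) has_derivative_diff) (simp add: algebra_simps)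

lemma has_d2_mult:
  "has_d2 f a b y \<Longrightarrow> has_d2 g c d y \<Longrightarrow>
    has_d2 (\<lambda>y. f y * g y) (a * g y + f y * c) (b * g y + f y * d) y"
  unfolding has_d2_def
  by (drule (1) has_derivative_mult) (simp add: algebra_simps)

lemma has_d2_power2:
  "has_d2 f a b y \<Longrightarrow> has_d2 (\<lambda>y. (f y)\<^sup>2) (2 * f y * a) (2 * f y * b) y"
  unfolding power2_eq_square by (rule has_d2_eq_rhs[OF has_d2_mult]) auto

lemma has_d2_DERIV:
  assumes "(h has_field_derivative k) (at (f y))" "has_d2 f a b y"
  shows "has_d2 (\<lambda>y. h (f y)) (k * a) (k * b) y"
  using has_derivative_compose[OF assms(2)[unfolded has_d2_def]
      assms(1)[unfolded has_field_derivative_def]]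
  by (simp add: has_d2_def algebra_simps)

lemma has_d2_divide:
  assumes "has_d2 f a b y" "has_d2 g c d y" "g y \<noteq> 0"
  shows "has_d2 (\<lambda>y. f y / g y) ((a * g y - f y * c) / (g y)\<^sup>2) ((b * g y - f y * d) / (g y)\<^sup>2) y"
proof -
  have "(inverse has_field_derivative - (inverse (g y) ^ 2)) (at (g y))"
    using DERIV_inverse[OF assms(3)] by (simp add: numeral_2_eq_2 One_nat_def)
  from has_d2_mult[OF assms(1) has_d2_DERIV[OF this assms(2)]] assms(3)
  show ?thesis by (simp add: divide_simps power2_eq_square algebra_simps)
qed

lemma has_d2_Pair:
  assumes "has_d2 F A B (f y, g y)" "has_d2 f a b y" "has_d2 g c d y"
  shows "has_d2 (\<lambda>y. F (f y, g y)) (A * a + B * c) (A * b + B * d) y"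
  using has_derivative_compose[OF has_derivative_Pair[OF assms(2,3)[unfolded has_d2_def]]
      assms(1)[unfolded has_d2_def]]
  by (simp add: has_d2_def algebra_simps)

lemma has_d2_transform:
  assumes "has_d2 f a b y" "open V" "y \<in> V" "\<And>z. z \<in> V \<Longrightarrow> f z = g z"
  shows "has_d2 g a b y"
  using has_derivative_transform_within_open[OF assms(1)[unfolded has_d2_def] assms(2,3)] assms(4)
  by (simp add: has_d2_def)

lemmas has_d2_intros =
  has_d2_const has_d2_fst has_d2_snd has_d2_add has_d2_uminus has_d2_diff has_d2_mult has_d2_power2

lemma holo2_iff: "holo2 f V \<longleftrightarrow> open V \<and> (\<forall>y\<in>V. \<exists>a b. has_d2 f a b y)"
  by (simp add: holo2_def has_d2_def)

lemma holo2I: "open V \<Longrightarrow> (\<And>y. y \<in> V \<Longrightarrow> has_d2 f (a y) (b y) y) \<Longrightarrow> holo2 f V"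
  by (auto simp: holo2_iff)

lemma holo2_open: "holo2 f V \<Longrightarrow> open V"
  by (simp add: holo2_def)

lemma holo2_has_d2: "holo2 f V \<Longrightarrow> y \<in> V \<Longrightarrow> has_d2 f (d2 1 f y) (d2 2 f y) y"
  by (metis holo2_iff has_d2_imp_d2)

lemma holo2_continuous_on: "holo2 f V \<Longrightarrow> continuous_on V f"
  using has_derivative_continuous unfolding holo2_def
  by (intro continuous_at_imp_continuous_on) blast

lemma holo2_subset: "holo2 f V \<Longrightarrow> open U \<Longrightarrow> U \<subseteq> V \<Longrightarrow> holo2 f U"
  unfolding holo2_iff by blast

lemma holo2_const: "open V \<Longrightarrow> holo2 (\<lambda>y. k) V"
  unfolding holo2_iff using has_d2_const by blast

lemma holo2_add: "holo2 f V \<Longrightarrow> holo2 g V \<Longrightarrow> holo2 (\<lambda>y. f y + g y) V"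
  unfolding holo2_iff using has_d2_add by blast

lemma holo2_uminus: "holo2 f V \<Longrightarrow> holo2 (\<lambda>y. - f y) V"
  unfolding holo2_iff using has_d2_uminus by blast

lemma holo2_diff: "holo2 f V \<Longrightarrow> holo2 g V \<Longrightarrow> holo2 (\<lambda>y. f y - g y) V"
  unfolding holo2_iff using has_d2_diff by blast

lemma holo2_mult: "holo2 f V \<Longrightarrow> holo2 g V \<Longrightarrow> holo2 (\<lambda>y. f y * g y) V"
  unfolding holo2_iff using has_d2_mult by blast

lemma holo2_divide:
  assumes "holo2 f V" "holo2 g V" "\<And>y. y \<in> V \<Longrightarrow> g y \<noteq> 0"
  shows "holo2 (\<lambda>y. f y / g y) V"
proof (rule holo2I[OF holo2_open[OF assms(1)]])
  fix y assume "y \<in> V"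
  then show "has_d2 (\<lambda>y. f y / g y) ((d2 1 f y * g y - f y * d2 1 g y) / (g y)\<^sup>2)
      ((d2 2 f y * g y - f y * d2 2 g y) / (g y)\<^sup>2) y"
    using assms by (intro has_d2_divide holo2_has_d2)
qed

lemma holo2_Pair:
  assumes "holo2 F W" "holo2 f V" "holo2 g V" "\<And>y. y \<in> V \<Longrightarrow> (f y, g y) \<in> W"
  shows "holo2 (\<lambda>y. F (f y, g y)) V"
  unfolding holo2_iff
proof (intro conjI ballI)
  fix y assume y: "y \<in> V"
  from has_d2_Pair[OF holo2_has_d2[OF assms(1) assms(4)[OF y]]
      holo2_has_d2[OF assms(2) y] holo2_has_d2[OF assms(3) y]]
  show "\<exists>a b. has_d2 (\<lambda>y. F (f y, g y)) a b y" by blast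
qed (rule holo2_open[OF assms(2)])

lemma holo2_cong:
  assumes "holo2 f V" "\<And>z. z \<in> V \<Longrightarrow> g z = f z"
  shows "holo2 g V"
proof (rule holo2I[OF holo2_open[OF assms(1)]])
  fix y assume "y \<in> V"
  then show "has_d2 g (d2 1 f y) (d2 2 f y) y"
    using has_d2_transform[OF holo2_has_d2[OF assms(1)] holo2_open[OF assms(1)]] assms(2) by simp
qed

lemma holo2_nonzero:
  assumes "holo2 f V"
  shows "holo2 f {y \<in> V. f y \<noteq> 0}"
proof -
  have "open (V \<inter> f -` (- {0}))"
    using holo2_continuous_on[OF assms] holo2_open[OF assms]
    by (rule continuous_open_preimage) (intro open_Compl closed_singleton)
  moreover have "V \<inter> f -` (- {0}) = {y \<in> V. f y \<noteq> 0}" by auto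
  ultimately show ?thesis using holo2_subset[OF assms] by auto
qed

lemma d2_cong:
  assumes "y \<in> V" "holo2 f V" "\<And>z. z \<in> V \<Longrightarrow> g z = f z"
  shows "d2 a g y = d2 a f y"
  using has_d2_imp_d2[OF has_d2_transform[OF holo2_has_d2[OF assms(2,1)] holo2_open[OF assms(2)]
        assms(1) assms(3)[symmetric]]] d2_cases[of a] by auto

lemma d2_const: "d2 a (\<lambda>y. k) y = 0"
  using has_d2_imp_d2[OF has_d2_const[of k y]] d2_cases[of a] by auto

lemma d2_add:
  assumes "holo2 f V" "holo2 g V" "y \<in> V"
  shows "d2 a (\<lambda>y. f y + g y) y = d2 a f y + d2 a g y"
  using has_d2_imp_d2[OF has_d2_add[OF holo2_has_d2[OF assms(1,3)] holo2_has_d2[OF assms(2,3)]]]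
    d2_cases[of a] by auto

lemma d2_uminus:
  assumes "holo2 f V" "y \<in> V"
  shows "d2 a (\<lambda>y. - f y) y = - d2 a f y"
  using has_d2_imp_d2[OF has_d2_uminus[OF holo2_has_d2[OF assms]]] d2_cases[of a] by auto

lemma d2_diff:
  assumes "holo2 f V" "holo2 g V" "y \<in> V"
  shows "d2 a (\<lambda>y. f y - g y) y = d2 a f y - d2 a g y"
  using has_d2_imp_d2[OF has_d2_diff[OF holo2_has_d2[OF assms(1,3)] holo2_has_d2[OF assms(2,3)]]]
    d2_cases[of a] by auto

lemma d2_mult:
  assumes "holo2 f V" "holo2 g V" "y \<in> V"
  shows "d2 a (\<lambda>y. f y * g y) y = d2 a f y * g y + f y * d2 a g y"
  using has_d2_imp_d2[OF has_d2_mult[OF holo2_has_d2[OF assms(1,3)] holo2_has_d2[OF assms(2,3)]]]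
    d2_cases[of a] by auto

lemma d2_divide:
  assumes "holo2 f V" "holo2 g V" "y \<in> V" "g y \<noteq> 0"
  shows "d2 a (\<lambda>y. f y / g y) y = (d2 a f y * g y - f y * d2 a g y) / (g y)\<^sup>2"
  using has_d2_imp_d2[OF has_d2_divide[OF holo2_has_d2[OF assms(1,3)]
        holo2_has_d2[OF assms(2,3)] assms(4)]] d2_cases[of a] by auto

lemma d2_Pair:
  assumes "holo2 F W" "holo2 f V" "holo2 g V" "y \<in> V" "(f y, g y) \<in> W"
  shows "d2 a (\<lambda>y. F (f y, g y)) y = d2 1 F (f y, g y) * d2 a f y + d2 2 F (f y, g y) * d2 a g y"
  using has_d2_imp_d2[OF has_d2_Pair[OF holo2_has_d2[OF assms(1,5)]
      holo2_has_d2[OF assms(2,4)] holo2_has_d2[OF assms(3,4)]]] d2_cases[of a] by auto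

section \<open>Second derivatives of holomorphic functions\<close>

lemma holo2_swap:
  assumes "holo2 f V"
  shows "holo2 (f \<circ> prod.swap) (prod.swap -` V)"
proof (rule holo2I)
  show "open (prod.swap -` V)"
    using holo2_open[OF assms] by (rule open_vimage) (rule continuous_on_swap)
  fix y assume "y \<in> prod.swap -` V"
  then have "has_d2 f (d2 1 f (prod.swap y)) (d2 2 f (prod.swap y)) (snd y, fst y)"
    using holo2_has_d2[OF assms, of "prod.swap y"] by (simp add: prod.swap_def)
  from has_d2_Pair[OF this has_d2_snd has_d2_fst]
  show "has_d2 (f \<circ> prod.swap) (d2 2 f (prod.swap y)) (d2 1 f (prod.swap y)) y"
    by (simp add: o_def prod.swap_def)
qed

lemma d2_1_swap: "d2 1 (f \<circ> prod.swap) \<circ> prod.swap = d2 2 f"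
  by (simp add: fun_eq_iff d2_def)

definition cauchy_deriv_kernel :: "complex \<Rightarrow> real \<Rightarrow> complex \<Rightarrow> real \<Rightarrow> complex" where
  "cauchy_deriv_kernel z0 r z t = (circlepath z0 r t - z0) / (circlepath z0 r t - z)\<^sup>2"

lemma continuous_on_circlepath: "continuous_on S (circlepath z r)"
  unfolding circlepath by (intro continuous_intros)

lemma circlepath_in_cball: "r > 0 \<Longrightarrow> circlepath z0 r t \<in> cball z0 r"
  by (simp add: circlepath dist_norm norm_mult)

lemma circlepath_neq: "z \<in> ball z0 r \<Longrightarrow> circlepath z0 r t \<noteq> z"
  by (auto simp: circlepath dist_norm norm_mult)

lemma d2_1_has_integral_circle:
  assumes f: "holo2 f V" and sub: "cball z0 r \<times> {w} \<subseteq> V" and z: "z \<in> ball z0 r"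
  shows "((\<lambda>t. f (circlepath z0 r t, w) * cauchy_deriv_kernel z0 r z t) has_integral d2 1 f (z, w))
    {0..1}"
proof -
  let ?g = "\<lambda>\<zeta>. f (\<zeta>, w)" and ?c = "circlepath z0 r"
  have "?g field_differentiable at \<zeta>" if "\<zeta> \<in> cball z0 r" for \<zeta>
  proof -
    have "(\<zeta>, w) \<in> V" using sub that by blast
    from has_d2_partials(1)[OF holo2_has_d2[OF f this]] show ?thesis
      by (auto simp: field_differentiable_def)
  qed
  then have hol: "?g holomorphic_on cball z0 r"
    by (simp add: holomorphic_on_def field_differentiable_at_within)
  have "((\<lambda>\<zeta>. ?g \<zeta> / (\<zeta> - z)\<^sup>2) has_contour_integral 2 * pi * \<i> * d2 1 f (z, w)) ?c"
    using Cauchy_has_contour_integral_higher_derivative_circlepath[of z0 r ?g z 1] z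
      holomorphic_on_imp_continuous_on[OF hol] holomorphic_on_subset[OF hol ball_subset_cball]
    by (simp add: d2_def numeral_2_eq_2 One_nat_def)
  from has_integral_mult_right[OF this[unfolded has_contour_integral_def], of "1 / (2 * pi * \<i>)"]
  have "((\<lambda>t. 1 / (2 * pi * \<i>) *
      (?g (?c t) / (?c t - z)\<^sup>2 * vector_derivative ?c (at t within {0..1})))
      has_integral d2 1 f (z, w)) {0..1}"
    by simp
  moreover have "1 / k * (a / b * (k * c)) = a * (c / b)" if "k \<noteq> 0" for k a b c :: complex
    using that by simp
  then have "1 / (2 * pi * \<i>) * (a / b * (2 * pi * \<i> * c)) = a * (c / b)" for a b c
    by (metis complex_i_not_zero mult_eq_0_iff of_real_eq_0_iff pi_neq_zero zero_neq_numeral)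
  moreover have "vector_derivative ?c (at t within {0..1}) = 2 * pi * \<i> * (?c t - z0)"
    if "t \<in> {0..1}" for t
    using that by (subst vector_derivative_circlepath01) (simp_all add: circlepath)
  ultimately show ?thesis
    by (elim has_integral_eq[rotated]) (simp only: cauchy_deriv_kernel_def)
qed

lemma open_contains_bidisc:
  fixes V :: "('a::metric_space \<times> 'b::metric_space) set"
  assumes "open V" "(z, w) \<in> V"
  obtains r where "r > 0" "cball z r \<times> cball w r \<subseteq> V"
proof -
  obtain A B where AB: "open A" "open B" "(z, w) \<in> A \<times> B" "A \<times> B \<subseteq> V"
    using open_prod_elim[OF assms] by blast
  obtain r s where "r > 0" "cball z r \<subseteq> A" "s > 0" "cball w s \<subseteq> B"
    using AB(1-3) open_contains_cball by (metis mem_Sigma_iff)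
  then show thesis
    using AB(4) by (intro that[of "min r s"]) (auto simp: subset_iff)
qed

lemma continuous_on_cauchy_deriv_integrand:
  assumes "continuous_on V g" "cball z0 r \<times> cball w0 r \<subseteq> V" "r > 0"
  shows "continuous_on ((ball z0 r \<times> ball w0 r) \<times> cbox 0 1)
    (\<lambda>(y, t). g (circlepath z0 r t, snd y) * cauchy_deriv_kernel z0 r (fst y) t)"
proof -
  note [continuous_intros] =
    continuous_on_compose2[OF continuous_on_circlepath[of UNIV]] continuous_on_compose2[OF assms(1)]
  show ?thesis
    unfolding case_prod_unfold cauchy_deriv_kernel_def
    using assms(2) circlepath_in_cball[OF assms(3)] circlepath_neq
    by (intro continuous_intros) (auto simp: subset_iff)
qed

lemma holo2_d2_1_continuous_on:
  assumes f: "holo2 f V"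
  shows "continuous_on V (d2 1 f)"
proof -
  have "isCont (d2 1 f) (z0, w0)" if p: "(z0, w0) \<in> V" for z0 w0
  proof -
    obtain r where r: "r > 0" "cball z0 r \<times> cball w0 r \<subseteq> V"
      using open_contains_bidisc[OF holo2_open[OF f] p] .
    let ?U = "ball z0 r \<times> ball w0 r"
    have "continuous_on ?U (\<lambda>y. integral (cbox 0 1)
        (\<lambda>t. f (circlepath z0 r t, snd y) * cauchy_deriv_kernel z0 r (fst y) t))"
      using continuous_on_cauchy_deriv_integrand[OF holo2_continuous_on[OF f] r(2,1)]
      by (rule integral_continuous_on_param)
    moreover have "integral (cbox 0 1)
        (\<lambda>t. f (circlepath z0 r t, snd y) * cauchy_deriv_kernel z0 r (fst y) t) = d2 1 f y"
      if "y \<in> ?U" for y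
      using d2_1_has_integral_circle[OF f, of z0 r "snd y" "fst y"] r(2) that
      by (intro integral_unique) (auto simp: subset_iff)
    ultimately have "continuous_on ?U (d2 1 f)"
      by (simp cong: continuous_on_cong)
    then show ?thesis
      using r(1) by (simp add: continuous_on_eq_continuous_at open_Times)
  qed
  then show ?thesis by (auto intro!: continuous_at_imp_continuous_on)
qed

lemma holo2_d2_2_continuous_on:
  assumes "holo2 f V"
  shows "continuous_on V (d2 2 f)"
proof -
  have "continuous_on (prod.swap ` V) (d2 1 (f \<circ> prod.swap))"
    by (rule continuous_on_subset[OF holo2_d2_1_continuous_on[OF holo2_swap[OF assms]]]) auto
  then show ?thesis
    unfolding d2_1_swap[symmetric] by (rule continuous_on_compose[OF continuous_on_swap])
qed

lemma has_field_derivative_cauchy_deriv_kernel: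
  assumes "z \<in> ball z0 r"
  shows "((\<lambda>z. cauchy_deriv_kernel z0 r z t) has_field_derivative
    2 * (circlepath z0 r t - z0) / (circlepath z0 r t - z) ^ 3) (at z)"
proof -
  let ?c = "circlepath z0 r t"
  have "((\<lambda>z. ?c - z) has_field_derivative - 1) (at z)"
    by (auto intro!: derivative_eq_intros)
  moreover have nz: "?c - z \<noteq> 0"
    using circlepath_neq[OF assms] by simp
  ultimately have deriv: "((\<lambda>z. (?c - z0) / (?c - z)\<^sup>2) has_field_derivative
      (0 * (?c - z)\<^sup>2 - (?c - z0) * (2 * (- 1 * (?c - z)))) / ((?c - z)\<^sup>2 * (?c - z)\<^sup>2)) (at z)"
    using DERIV_divide[OF DERIV_const DERIV_power, of "\<lambda>z. ?c - z" "- 1" z UNIV 2] by simp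
  have "(0 * u\<^sup>2 - v * (2 * (- 1 * u))) / (u\<^sup>2 * u\<^sup>2) = 2 * v / u ^ 3"
    if "u \<noteq> 0" for u v :: complex
    using that by (simp add: power2_eq_square power3_eq_cube mult_ac)
  from DERIV_cong[OF deriv this[OF nz]] show ?thesis
    unfolding cauchy_deriv_kernel_def .
qed

lemma has_d2_cauchy_deriv_integrand:
  assumes f: "holo2 f V" and V: "(circlepath z0 r t, snd y) \<in> V" and y: "fst y \<in> ball z0 r"
  shows "has_d2 (\<lambda>y. f (circlepath z0 r t, snd y) * cauchy_deriv_kernel z0 r (fst y) t)
    (f (circlepath z0 r t, snd y) *
      (2 * (circlepath z0 r t - z0) / (circlepath z0 r t - fst y) ^ 3))
    (d2 2 f (circlepath z0 r t, snd y) * cauchy_deriv_kernel z0 r (fst y) t) y"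
proof -
  let ?c = "circlepath z0 r t"
  have "((\<lambda>w. f (?c, w)) has_field_derivative d2 2 f (?c, snd y)) (at (snd y))"
    using has_d2_partials(2)[OF holo2_has_d2[OF f V]] by simp
  from has_d2_mult[OF has_d2_DERIV[OF this has_d2_snd]
      has_d2_DERIV[OF has_field_derivative_cauchy_deriv_kernel[OF y] has_d2_fst]]
  show ?thesis by (rule has_d2_eq_rhs) simp_all
qed

lemma continuous_on_slice:
  assumes "continuous_on (S \<times> T) (\<lambda>(x, y). f x y)" "x \<in> S"
  shows "continuous_on T (f x)"
  using continuous_on_compose2[OF assms(1), of T "\<lambda>y. (x, y)"] assms(2)
  by (simp add: continuous_on_Pair image_subset_iff)

lemma has_d2_integral:
  fixes F :: "pt2 \<Rightarrow> real \<Rightarrow> complex"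
  assumes U: "open U" "convex U" and y: "y \<in> U"
    and F: "\<And>y t. y \<in> U \<Longrightarrow> has_d2 (\<lambda>y. F y t) (A y t) (B y t) y"
    and int: "\<And>y. y \<in> U \<Longrightarrow> F y integrable_on {a..b}"
    and contA: "continuous_on (U \<times> {a..b}) (\<lambda>(y, t). A y t)"
    and contB: "continuous_on (U \<times> {a..b}) (\<lambda>(y, t). B y t)"
  shows "has_d2 (\<lambda>y. integral {a..b} (F y)) (integral {a..b} (A y)) (integral {a..b} (B y)) y"
proof -
  define D where "D y t = (blinfun_mult_right (A y t) o\<^sub>L fst_blinfun) +
    (blinfun_mult_right (B y t) o\<^sub>L snd_blinfun)" for y t
  have D: "blinfun_apply (D y t) = (\<lambda>v. A y t * fst v + B y t * snd v)" for y t
    by (simp add: fun_eq_iff D_def blinfun.add_left)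
  have contD: "continuous_on (U \<times> {a..b}) (\<lambda>(y, t). D y t)"
    using contA contB unfolding case_prod_unfold D_def by (intro continuous_intros)
  have "((\<lambda>y. integral (cbox a b) (F y)) has_derivative integral (cbox a b) (D y)) (at y within U)"
    using F int contD
    by (intro leibniz_rule[OF _ _ _ y U(2)]) (simp_all add: has_d2_def D has_derivative_at_withinI)
  then have "((\<lambda>y. integral {a..b} (F y)) has_derivative integral {a..b} (D y)) (at y)"
    by (simp add: at_within_open[OF y U(1)])
  moreover have "blinfun_apply (integral {a..b} (D y)) =
      (\<lambda>v. integral {a..b} (A y) * fst v + integral {a..b} (B y) * snd v)"
  proof
    fix v
    have "A y integrable_on {a..b}" "B y integrable_on {a..b}" "D y integrable_on {a..b}"
      using continuous_on_slice[OF contA y] continuous_on_slice[OF contB y]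
        continuous_on_slice[OF contD y]
      by (auto intro: integrable_continuous_interval)
    then show "integral {a..b} (D y) v =
        integral {a..b} (A y) * fst v + integral {a..b} (B y) * snd v"
      by (simp add: blinfun_apply_integral D Henstock_Kurzweil_Integration.integral_add
          integrable_on_mult_left)
  qed
  ultimately show ?thesis by (simp add: has_d2_def)
qed

text \<open>Cauchy's integral formula in the first variable, differentiated under the integral sign.\<close>

lemma has_d2_d2_1_circle:
  assumes f: "holo2 f V" and r: "r > 0" "cball z0 r \<times> cball w0 r \<subseteq> V"
    and y: "y \<in> ball z0 r \<times> ball w0 r"
  obtains a where "has_d2 (d2 1 f) a
    (integral {0..1}
      (\<lambda>t. d2 2 f (circlepath z0 r t, snd y) * cauchy_deriv_kernel z0 r (fst y) t)) y"
proof -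
  let ?U = "ball z0 r \<times> ball w0 r" and ?c = "circlepath z0 r"
  let ?F = "\<lambda>y t. f (?c t, snd y) * cauchy_deriv_kernel z0 r (fst y) t"
  let ?A = "\<lambda>y t. f (?c t, snd y) * (2 * (?c t - z0) / (?c t - fst y) ^ 3)"
  let ?B = "\<lambda>y t. d2 2 f (?c t, snd y) * cauchy_deriv_kernel z0 r (fst y) t"
  have in_V: "(?c t, snd y) \<in> V" if "y \<in> ?U" for y t
    using that r(2) circlepath_in_cball[OF r(1), of z0 t] by (auto simp: subset_iff)
  have F: "(?F y has_integral d2 1 f y) {0..1}" if "y \<in> ?U" for y
    using d2_1_has_integral_circle[OF f, of z0 r "snd y" "fst y"] r(2) that
    by (auto simp: subset_iff mem_Times_iff)
  have "has_d2 (\<lambda>y. integral {0..1} (?F y)) (integral {0..1} (?A y)) (integral {0..1} (?B y)) y"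
  proof (rule has_d2_integral[OF _ _ y])
    show "has_d2 (\<lambda>y. ?F y t) (?A y t) (?B y t) y" if "y \<in> ?U" for y t
      using that
      by (intro has_d2_cauchy_deriv_integrand[OF f in_V[OF that]]) (simp add: mem_Times_iff)
    show "?F y integrable_on {0..1}" if "y \<in> ?U" for y
      using F[OF that] by blast
    note [continuous_intros] = continuous_on_compose2[OF continuous_on_circlepath[of UNIV]]
      continuous_on_compose2[OF holo2_continuous_on[OF f]]
    show "continuous_on (?U \<times> {0..1}) (\<lambda>(y, t). ?A y t)"
      unfolding case_prod_unfold using in_V circlepath_neq
      by (intro continuous_intros) (auto simp: mem_Times_iff)
    show "continuous_on (?U \<times> {0..1}) (\<lambda>(y, t). ?B y t)"
      using continuous_on_cauchy_deriv_integrand[OF holo2_d2_2_continuous_on[OF f] r(2,1)] by simp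
  qed (intro open_Times open_ball convex_Times convex_ball)+
  then have "has_d2 (d2 1 f) (integral {0..1} (?A y)) (integral {0..1} (?B y)) y"
    by (rule has_d2_transform[OF _ _ y integral_unique[OF F]]) (simp_all add: open_Times)
  then show thesis by (rule that)
qed

lemma holo2_d2_1:
  assumes f: "holo2 f V"
  shows "holo2 (d2 1 f) V"
  unfolding holo2_iff
proof (intro conjI ballI)
  fix y assume "y \<in> V"
  then obtain r where r: "r > 0" "cball (fst y) r \<times> cball (snd y) r \<subseteq> V"
    using open_contains_bidisc[OF holo2_open[OF f], of "fst y" "snd y"] by auto
  have "y \<in> ball (fst y) r \<times> ball (snd y) r" using r(1) by (simp add: mem_Times_iff)
  from has_d2_d2_1_circle[OF f r this] show "\<exists>a b. has_d2 (d2 1 f) a b y" by metis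
qed (rule holo2_open[OF f])

lemma holo2_d2_2:
  assumes "holo2 f V"
  shows "holo2 (d2 2 f) V"
proof -
  have "prod.swap -` prod.swap -` V = V" by (simp add: vimage_def)
  then show ?thesis
    using holo2_swap[OF holo2_d2_1[OF holo2_swap[OF assms]]] by (simp add: d2_1_swap)
qed

lemma holo2_d2: "holo2 f V \<Longrightarrow> holo2 (d2 a f) V"
  using holo2_d2_1 holo2_d2_2 d2_cases[of a] by auto

lemma d2_2_d2_1:
  assumes f: "holo2 f V" and y: "y \<in> V"
  shows "d2 2 (d2 1 f) y = d2 1 (d2 2 f) y"
proof -
  obtain r where r: "r > 0" "cball (fst y) r \<times> cball (snd y) r \<subseteq> V"
    using open_contains_bidisc[OF holo2_open[OF f], of "fst y" "snd y"] y by auto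
  have "y \<in> ball (fst y) r \<times> ball (snd y) r" using r(1) by (simp add: mem_Times_iff)
  from has_d2_d2_1_circle[OF f r this] have "d2 2 (d2 1 f) y =
      integral {0..1} (\<lambda>t. d2 2 f (circlepath (fst y) r t, snd y) *
        cauchy_deriv_kernel (fst y) r (fst y) t)"
    by (metis has_d2_imp_d2(2))
  also have "\<dots> = d2 1 (d2 2 f) y"
    using d2_1_has_integral_circle[OF holo2_d2_2[OF f], of "fst y" r "snd y" "fst y"] r
    by (intro integral_unique) (auto simp: subset_iff)
  finally show ?thesis .
qed

lemma d2_commute:
  assumes "holo2 f V" "y \<in> V"
  shows "d2 a (d2 b f) y = d2 b (d2 a f) y"
  using d2_2_d2_1[OF assms] d2_cases[of a] d2_cases[of b] by auto

section \<open>Mixed logarithmic derivatives and Jacobians\<close>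

text \<open>This is \<open>F\<^sup>2\<close> times the mixed second derivative of \<open>log F\<close>.\<close>

definition mixed_log :: "(pt2 \<Rightarrow> complex) \<Rightarrow> pt2 \<Rightarrow> complex" where
  "mixed_log F w = F w * d2 2 (d2 1 F) w - d2 1 F w * d2 2 F w"

lemma mixed_log_has_d2:
  assumes F: "\<And>z. has_d2 F (F1 z) (F2 z) z" and F1: "has_d2 F1 F11 F12 w"
  shows "mixed_log F w = F w * F12 - F1 w * F2 w"
proof -
  have "d2 1 F = F1" using has_d2_imp_d2(1)[OF F] by auto
  then show ?thesis
    by (simp add: mixed_log_def has_d2_imp_d2(2)[OF F] has_d2_imp_d2(2)[OF F1])
qed

lemma mixed_log_cong:
  assumes F: "holo2 F W" and w: "w \<in> W" and eq: "\<And>z. z \<in> W \<Longrightarrow> G z = F z"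
  shows "mixed_log G w = mixed_log F w"
proof -
  have "d2 2 (d2 1 G) w = d2 2 (d2 1 F) w"
    by (rule d2_cong[OF w holo2_d2[OF F] d2_cong[OF _ F eq]])
  then show ?thesis
    by (simp add: mixed_log_def d2_cong[OF w F eq] eq[OF w])
qed

lemma mixed_log_mult:
  assumes F: "holo2 F W" and G: "holo2 G W" and w: "w \<in> W"
  shows "mixed_log (\<lambda>z. F z * G z) w = (F w)\<^sup>2 * mixed_log G w + (G w)\<^sup>2 * mixed_log F w"
proof -
  have holo: "holo2 F W" "holo2 G W" "holo2 (d2 1 F) W" "holo2 (d2 1 G) W"
    using F G by (auto intro: holo2_d2)
  have "d2 2 (d2 1 (\<lambda>z. F z * G z)) w = d2 2 (\<lambda>z. d2 1 F z * G z + F z * d2 1 G z) w"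
  proof (rule d2_cong[OF w])
    show "holo2 (\<lambda>z. d2 1 F z * G z + F z * d2 1 G z) W"
      using holo by (intro holo2_add holo2_mult)
  qed (rule d2_mult[OF F G])
  also have "\<dots> = d2 2 (d2 1 F) w * G w + d2 1 F w * d2 2 G w
      + (d2 2 F w * d2 1 G w + F w * d2 2 (d2 1 G) w)"
    using holo w by (simp add: d2_add[of _ W] d2_mult[of _ W] holo2_mult)
  finally show ?thesis
    by (simp add: mixed_log_def d2_mult[OF F G w] power2_eq_square algebra_simps)
qed

lemma mixed_log_power2:
  assumes "holo2 F W" "w \<in> W"
  shows "mixed_log (\<lambda>z. (F z)\<^sup>2) w = 2 * (F w)\<^sup>2 * mixed_log F w"
  using mixed_log_mult[OF assms(1,1,2)] by (simp add: power2_eq_square)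

lemma mixed_log_divide_zero_imp:
  assumes F: "holo2 F W" and G: "holo2 G W" and w: "w \<in> W" and nz: "\<And>z. z \<in> W \<Longrightarrow> G z \<noteq> 0"
    and zero: "mixed_log (\<lambda>z. F z / G z) w = 0"
  shows "(G w)\<^sup>2 * mixed_log F w = (F w)\<^sup>2 * mixed_log G w"
proof -
  have ratio: "holo2 (\<lambda>z. F z / G z) W"
    using F G nz by (rule holo2_divide)
  have "mixed_log F w = mixed_log (\<lambda>z. F z / G z * G z) w"
    using nz by (intro mixed_log_cong[OF holo2_mult[OF ratio G] w]) simp
  also have "\<dots> = (F w / G w)\<^sup>2 * mixed_log G w"
    using mixed_log_mult[OF ratio G w] zero by simp
  finally show ?thesis
    using nz[OF w] by (simp add: power_divide)
qed

lemma d2_2_log_derivative: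
  assumes F: "holo2 F W" and w: "w \<in> W" and nz: "F w \<noteq> 0"
  shows "d2 2 (\<lambda>z. d2 1 F z / F z) w = mixed_log F w / (F w)\<^sup>2"
  by (simp add: d2_divide[OF holo2_d2[OF F] F w nz] mixed_log_def mult.commute)

definition jacobian :: "(pt2 \<Rightarrow> complex) \<Rightarrow> (pt2 \<Rightarrow> complex) \<Rightarrow> pt2 \<Rightarrow> complex" where
  "jacobian f g y = d2 1 f y * d2 2 g y - d2 2 f y * d2 1 g y"

lemma holo2_jacobian: "holo2 f V \<Longrightarrow> holo2 g V \<Longrightarrow> holo2 (jacobian f g) V"
  unfolding jacobian_def[abs_def] by (intro holo2_diff holo2_mult holo2_d2)

lemma jacobian_nonzero_imp_gradients_nonzero:
  assumes "jacobian f g z \<noteq> 0"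
  shows "d2 1 f z \<noteq> 0 \<or> d2 2 f z \<noteq> 0" "d2 1 g z \<noteq> 0 \<or> d2 2 g z \<noteq> 0"
  using assms by (auto simp: jacobian_def)

lemma jacobian_Pair_left:
  assumes "holo2 F W" "holo2 f V" "holo2 g V" "y \<in> V" "(f y, g y) \<in> W"
  shows "jacobian (\<lambda>z. F (f z, g z)) f y = - d2 2 F (f y, g y) * jacobian f g y"
  unfolding jacobian_def d2_Pair[OF assms] by (simp add: algebra_simps)

lemma d2_1_eq_coframe_coefficient:
  assumes F: "holo2 F W" and fg: "holo2 f V" "holo2 g V" "y \<in> V" "(f y, g y) \<in> W"
    and jac: "jacobian f g y \<noteq> 0"
    and dF: "\<And>a. a \<in> {1, 2} \<Longrightarrow> d2 a (\<lambda>z. F (f z, g z)) y = s * d2 a f y + t * d2 a g y"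
  shows "d2 1 F (f y, g y) = s"
proof -
  have "(d2 1 F (f y, g y) - s) * d2 a f y + (d2 2 F (f y, g y) - t) * d2 a g y = 0"
    if "a \<in> {1, 2}" for a
    using dF[OF that] d2_Pair[OF F fg, of a] by (simp add: algebra_simps)
  from this[of 1] this[of 2] have "(d2 1 F (f y, g y) - s) * jacobian f g y = 0"
    unfolding jacobian_def by simp algebra
  then show ?thesis using jac by simp
qed

section \<open>Flat connections and foliations\<close>

locale torsion_free_connection =
  fixes Gam :: "nat \<Rightarrow> nat \<Rightarrow> nat \<Rightarrow> pt2 \<Rightarrow> complex" and V :: "pt2 set"
  assumes holo2_Gam: "a \<in> {1, 2} \<Longrightarrow> b \<in> {1, 2} \<Longrightarrow> c \<in> {1, 2} \<Longrightarrow> holo2 (Gam c a b) V"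
    and torsion_free: "a \<in> {1, 2} \<Longrightarrow> b \<in> {1, 2} \<Longrightarrow> c \<in> {1, 2} \<Longrightarrow> y \<in> V \<Longrightarrow>
      Gam c a b y = Gam c b a y"
begin

definition hessian :: "(pt2 \<Rightarrow> complex) \<Rightarrow> nat \<Rightarrow> nat \<Rightarrow> pt2 \<Rightarrow> complex" where
  "hessian f a b y = d2 a (d2 b f) y - (\<Sum>c\<in>{1, 2}. Gam c a b y * d2 c f y)"

text \<open>The foliation by level sets of f is preserved by the connection exactly when the Hessian
  of f is a multiple of \<open>df \<otimes> df\<close>.\<close>

definition hessian_multiplier :: "(pt2 \<Rightarrow> complex) \<Rightarrow> complex \<Rightarrow> pt2 \<Rightarrow> bool" where
  "hessian_multiplier f s y \<longleftrightarrow>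
    (\<forall>a\<in>{1, 2}. \<forall>b\<in>{1, 2}. hessian f a b y = s * (d2 a f y * d2 b f y))"

definition flat :: bool where
  "flat \<longleftrightarrow> (\<forall>y\<in>V. \<forall>a\<in>{1, 2}. \<forall>b\<in>{1, 2}. \<forall>c\<in>{1, 2}. \<forall>d\<in>{1, 2}. curv Gam d c a b y = 0)"

lemma d2_d2_eq_hessian: "d2 a (d2 b f) y = hessian f a b y + (\<Sum>c\<in>{1, 2}. Gam c a b y * d2 c f y)"
  by (simp add: hessian_def)

lemma hessian_multiplierD:
  "hessian_multiplier f s y \<Longrightarrow> a \<in> {1, 2} \<Longrightarrow> b \<in> {1, 2} \<Longrightarrow>
    hessian f a b y = s * (d2 a f y * d2 b f y)"
  unfolding hessian_multiplier_def by blast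

lemma hessian_commute:
  assumes "holo2 f V" "y \<in> V" "a \<in> {1, 2}" "b \<in> {1, 2}"
  shows "hessian f a b y = hessian f b a y"
  unfolding hessian_def d2_commute[OF assms(1,2), of a b]
  using torsion_free[OF assms(3,4) _ assms(2)] by simp

lemma ricci_identity:
  assumes f: "holo2 f V" and y: "y \<in> V" and c: "c \<in> {1, 2}"
  shows "d2 1 (hessian f 2 c) y - d2 2 (hessian f 1 c) y
      + (\<Sum>e\<in>{1, 2}. Gam e 2 c y * hessian f 1 e y - Gam e 1 c y * hessian f 2 e y)
    = - (\<Sum>d\<in>{1, 2}. curv Gam d c 1 2 y * d2 d f y)"
proof -
  have d2_hessian: "d2 a (hessian f b c) y = d2 a (d2 b (d2 c f)) y
      - (\<Sum>e\<in>{1, 2}. d2 a (Gam e b c) y * d2 e f y + Gam e b c y * d2 a (d2 e f) y)"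
    if "b \<in> {1, 2}" for a b
  proof -
    have "holo2 (\<lambda>y. Gam e b c y * d2 e f y) V" if "e \<in> {1, 2}" for e
      using holo2_Gam \<open>b \<in> {1, 2}\<close> c that by (intro holo2_mult holo2_d2[OF f]) auto
    moreover have "hessian f b c =
        (\<lambda>y. d2 b (d2 c f) y - Gam 1 b c y * d2 1 f y - Gam 2 b c y * d2 2 f y)"
      by (simp add: hessian_def fun_eq_iff)
    ultimately show ?thesis
      using that c y holo2_Gam f
      by (simp add: d2_diff[of _ V] d2_mult[of _ V] holo2_diff holo2_d2)
  qed
  show ?thesis
    unfolding d2_hessian[of 1, simplified] d2_hessian[of 2, simplified]
    using d2_commute[OF holo2_d2[OF f] y, of 1 2 c]
    by (simp add: hessian_def curv_def algebra_simps)
qed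

text \<open>Here \<open>s df\<close> is the connection form on the line subbundle of the cotangent bundle spanned
  by \<open>df\<close>, so flatness makes it closed.\<close>

lemma flat_imp_jacobian_multiplier_zero:
  assumes flat and f: "holo2 f V" and s: "holo2 s V" and y: "y \<in> V"
    and mult: "\<And>z. z \<in> V \<Longrightarrow> hessian_multiplier f (s z) z"
    and gradient: "d2 1 f y \<noteq> 0 \<or> d2 2 f y \<noteq> 0"
  shows "jacobian s f y = 0"
proof -
  have "jacobian s f y * d2 c f y = 0" if c: "c \<in> {1, 2}" for c
  proof -
    note hessian_eq = hessian_multiplierD[OF mult]
    have d2_hessian: "d2 a (hessian f b c) y = d2 a s y * (d2 b f y * d2 c f y)
        + s y * (d2 a (d2 b f) y * d2 c f y + d2 b f y * d2 a (d2 c f) y)"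
      if "b \<in> {1, 2}" for a b
    proof -
      have holo: "holo2 (\<lambda>z. d2 b f z * d2 c f z) V"
        by (intro holo2_mult holo2_d2[OF f])
      have "d2 a (hessian f b c) y = d2 a (\<lambda>z. s z * (d2 b f z * d2 c f z)) y"
        by (rule d2_cong[OF y holo2_mult[OF s holo]]) (rule hessian_eq[OF _ that c])
      also have "\<dots> = d2 a s y * (d2 b f y * d2 c f y)
          + s y * (d2 a (d2 b f) y * d2 c f y + d2 b f y * d2 a (d2 c f) y)"
        unfolding d2_mult[OF s holo y] d2_mult[OF holo2_d2[OF f] holo2_d2[OF f] y] ..
      finally show ?thesis .
    qed
    have "curv Gam d c 1 2 y = 0" if "d \<in> {1, 2}" for d
      using \<open>flat\<close> y c that unfolding flat_def by blast
    then have "d2 1 (hessian f 2 c) y - d2 2 (hessian f 1 c) y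
        + (\<Sum>e\<in>{1, 2}. Gam e 2 c y * hessian f 1 e y - Gam e 1 c y * hessian f 2 e y) = 0"
      unfolding ricci_identity[OF f y c] by simp
    moreover have "d2 1 (hessian f 2 c) y - d2 2 (hessian f 1 c) y
        + (\<Sum>e\<in>{1, 2}. Gam e 2 c y * hessian f 1 e y - Gam e 1 c y * hessian f 2 e y)
      = jacobian s f y * d2 c f y + s y * (d2 2 f y * hessian f 1 c y - d2 1 f y * hessian f 2 c y)"
      using d2_commute[OF f y, of 1 2] c
      by (simp add: d2_hessian hessian_eq[OF y] d2_d2_eq_hessian[of _ c] jacobian_def algebra_simps)
    moreover have "d2 2 f y * hessian f 1 c y - d2 1 f y * hessian f 2 c y = 0"
      using c by (simp add: hessian_eq[OF y])
    ultimately show ?thesis by simp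
  qed
  then show ?thesis using gradient by (metis insertI1 insertI2 mult_eq_0_iff)
qed

lemma ex_hessian_multiplier:
  assumes f: "holo2 f V" and y: "y \<in> V"
    and leaf: "\<And>a. a \<in> {1, 2} \<Longrightarrow> hessian f a 1 y * d2 2 f y = hessian f a 2 y * d2 1 f y"
    and gradient: "d2 1 f y \<noteq> 0 \<or> d2 2 f y \<noteq> 0"
  shows "\<exists>s. hessian_multiplier f s y"
proof -
  have hessian_eq: "hessian f 1 1 y * d2 2 f y = hessian f 1 2 y * d2 1 f y"
    "hessian f 1 2 y * d2 2 f y = hessian f 2 2 y * d2 1 f y" "hessian f 2 1 y = hessian f 1 2 y"
    using leaf[of 1] leaf[of 2] hessian_commute[OF f y, of 2 1] by simp_all
  show ?thesis
  proof (cases "d2 1 f y = 0")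
    case True
    then have "hessian_multiplier f (hessian f 2 2 y / (d2 2 f y)\<^sup>2) y"
      using hessian_eq gradient by (simp add: hessian_multiplier_def power2_eq_square)
    then show ?thesis ..
  next
    case False
    then have "hessian f 1 2 y = hessian f 1 1 y * d2 2 f y / d2 1 f y"
      "hessian f 2 2 y = hessian f 1 2 y * d2 2 f y / d2 1 f y"
      using hessian_eq by (simp_all add: field_simps)
    then have "hessian_multiplier f (hessian f 1 1 y / (d2 1 f y)\<^sup>2) y"
      using hessian_eq(3) False by (simp add: hessian_multiplier_def power2_eq_square)
    then show ?thesis ..
  qed
qed

lemma d2_jacobian:
  assumes f: "holo2 f V" "hessian_multiplier f s y" and g: "holo2 g V" "hessian_multiplier g t y"
    and y: "y \<in> V" and a: "a \<in> {1, 2}"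
  shows "d2 a (jacobian f g) y =
    ((\<Sum>c\<in>{1, 2}. Gam c a c y) + s * d2 a f y + t * d2 a g y) * jacobian f g y"
proof -
  have "d2 a (jacobian f g) y = d2 a (d2 1 f) y * d2 2 g y + d2 1 f y * d2 a (d2 2 g) y
      - (d2 a (d2 2 f) y * d2 1 g y + d2 2 f y * d2 a (d2 1 g) y)"
    unfolding jacobian_def[abs_def] using y f(1) g(1)
    by (simp add: d2_diff[of _ V] d2_mult[of _ V] holo2_mult holo2_d2)
  then show ?thesis
    using hessian_multiplierD[OF f(2) a] hessian_multiplierD[OF g(2) a]
    by (simp add: d2_d2_eq_hessian jacobian_def algebra_simps)
qed

text \<open>The hypothesis on D says \<open>d log D = k (s df + t dg)\<close>, so \<open>k s\<close> is the logarithmic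
  derivative of D in its first argument, and closedness of \<open>s df\<close> kills the mixed derivative
  of \<open>log D\<close>.\<close>

lemma flat_imp_mixed_log_zero:
  assumes flat and f: "holo2 f V" and g: "holo2 g V" and D: "holo2 D W" and y: "y \<in> V"
    and in_W: "\<And>z. z \<in> V \<Longrightarrow> (f z, g z) \<in> W" and nz: "\<And>w. w \<in> W \<Longrightarrow> D w \<noteq> 0"
    and jac: "\<And>z. z \<in> V \<Longrightarrow> jacobian f g z \<noteq> 0" and "k \<noteq> 0"
    and mult: "\<And>z. z \<in> V \<Longrightarrow> hessian_multiplier f (s z) z"
    and dlog: "\<And>z a. z \<in> V \<Longrightarrow> a \<in> {1, 2} \<Longrightarrow>
      d2 a (\<lambda>z. D (f z, g z)) z = k * D (f z, g z) * (s z * d2 a f z + t z * d2 a g z)"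
  shows "mixed_log D (f y, g y) = 0"
proof -
  define R where "R w = 1 / k * (d2 1 D w / D w)" for w
  have const: "holo2 (\<lambda>w. 1 / k) W" and quot: "holo2 (\<lambda>w. d2 1 D w / D w) W"
    using D nz by (simp_all add: holo2_const holo2_open holo2_divide holo2_d2)
  have R: "holo2 R W"
    unfolding R_def using const quot by (rule holo2_mult)
  have "s z = R (f z, g z)" if z: "z \<in> V" for z
  proof -
    have "d2 1 D (f z, g z) = k * D (f z, g z) * s z"
      using dlog[OF z]
      by (intro d2_1_eq_coframe_coefficient[OF D f g z in_W[OF z] jac[OF z],
            where t = "k * D (f z, g z) * t z"]) (simp add: algebra_simps)
    then show ?thesis
      using nz[OF in_W[OF z]] \<open>k \<noteq> 0\<close> by (simp add: R_def)
  qed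
  then have "jacobian (\<lambda>z. R (f z, g z)) f y = 0"
    using mult jacobian_nonzero_imp_gradients_nonzero(1)[OF jac[OF y]]
    by (intro flat_imp_jacobian_multiplier_zero[OF \<open>flat\<close> f holo2_Pair[OF R f g in_W] y]) simp_all
  then have "d2 2 R (f y, g y) = 0"
    using jac[OF y] by (simp add: jacobian_Pair_left[OF R f g y in_W[OF y]])
  moreover have "d2 2 R (f y, g y) = 1 / k * (mixed_log D (f y, g y) / (D (f y, g y))\<^sup>2)"
    unfolding R_def d2_mult[OF const quot in_W[OF y]] d2_const
      d2_2_log_derivative[OF D in_W[OF y] nz[OF in_W[OF y]]] by simp
  ultimately show ?thesis
    using nz[OF in_W[OF y]] \<open>k \<noteq> 0\<close> by simp
qed

end

section \<open>Charts of a surface in three-space\<close>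

lemma coord_simps [simp]:
  "coord 1 x = fst x" "coord 2 x = fst (snd x)" "coord 3 x = snd (snd x)"
  by (simp_all add: coord_def)

definition holo3 :: "(pt3 \<Rightarrow> complex) \<Rightarrow> bool" where
  "holo3 P \<longleftrightarrow> (\<forall>x. (P has_derivative (\<lambda>v. \<Sum>k\<in>{1, 2, 3}. pdP P k x * coord k v)) (at x))"

lemma has_derivative_imp_pdP:
  assumes P: "(P has_derivative (\<lambda>v. \<Sum>k\<in>{1, 2, 3}. A k * coord k v)) (at x)" and k: "k \<in> {1, 2, 3}"
  shows "pdP P k x = A k"
proof -
  have "((\<lambda>t. upd3 k t x) has_derivative (\<lambda>h. upd3 k h 0)) (at (coord k x))"
    using k by (cases x) (auto simp: upd3_def
        intro!: has_derivative_Pair has_derivative_ident has_derivative_const)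
  moreover have "(P has_derivative (\<lambda>v. \<Sum>l\<in>{1, 2, 3}. A l * coord l v)) (at (upd3 k (coord k x) x))"
    using P k by (auto simp: upd3_def)
  ultimately have "((\<lambda>t. P (upd3 k t x)) has_derivative
      (\<lambda>h. \<Sum>l\<in>{1, 2, 3}. A l * coord l (upd3 k h 0))) (at (coord k x))"
    by (rule has_derivative_compose)
  moreover have "(\<lambda>h. \<Sum>l\<in>{1, 2, 3}. A l * coord l (upd3 k h 0)) = (*) (A k)"
    using k by (auto simp: upd3_def fun_eq_iff)
  ultimately show ?thesis
    by (simp add: pdP_def DERIV_imp_deriv has_field_derivative_def)
qed

lemma holo3I:
  assumes "\<And>x. (P has_derivative (\<lambda>v. \<Sum>k\<in>{1, 2, 3}. A k x * coord k v)) (at x)"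
  shows "holo3 P"
  unfolding holo3_def
proof
  fix x
  have "pdP P k x = A k x" if "k \<in> {1, 2, 3}" for k
    using has_derivative_imp_pdP[OF assms that] .
  then show "(P has_derivative (\<lambda>v. \<Sum>k\<in>{1, 2, 3}. pdP P k x * coord k v)) (at x)"
    using assms[of x] by simp
qed

definition cyclic3 :: "nat \<Rightarrow> nat \<Rightarrow> nat \<Rightarrow> bool" where
  "cyclic3 i j k \<longleftrightarrow> (i, j, k) \<in> {(1, 2, 3), (2, 3, 1), (3, 1, 2)}"

lemma cyclic3_in: "cyclic3 i j k \<Longrightarrow> i \<in> {1, 2, 3} \<and> j \<in> {1, 2, 3} \<and> k \<in> {1, 2, 3}"
  by (auto simp: cyclic3_def)

lemma pair_region_cyclic: "cyclic3 i j k \<Longrightarrow> pair_region P i j = {x \<in> surf P. pdP P k x \<noteq> 0}"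
  unfolding cyclic3_def by (elim insertE emptyE) (simp_all add: pair_region_def)

lemma cross_eq_Omega:
  assumes cyc: "cyclic3 i j k" and l: "l \<in> {1, 2, 3}" "pdP P l x \<noteq> 0"
    and u: "(\<Sum>k\<in>{1, 2, 3}. pdP P k x * coord k u) = 0"
    and v: "(\<Sum>k\<in>{1, 2, 3}. pdP P k x * coord k v) = 0"
  shows "coord i u * coord j v - coord j u * coord i v = Omega P x u v * pdP P k x"
proof -
  define A B C where "A = pdP P 1 x" and "B = pdP P 2 x" and "C = pdP P 3 x"
  define X Y Z where "X = coord 2 u * coord 3 v - coord 3 u * coord 2 v"
    and "Y = coord 3 u * coord 1 v - coord 1 u * coord 3 v"
    and "Z = coord 1 u * coord 2 v - coord 2 u * coord 1 v"
  have "A * coord 1 u + B * coord 2 u + C * coord 3 u = 0"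
    "A * coord 1 v + B * coord 2 v + C * coord 3 v = 0"
    using u v by (simp_all add: A_def B_def C_def add.assoc)
  then have "B * Z = C * Y" "C * X = A * Z" "A * Y = B * X"
    unfolding X_def Y_def Z_def by algebra+
  moreover have "A \<noteq> 0 \<or> B \<noteq> 0 \<or> C \<noteq> 0"
    using l by (auto simp: A_def B_def C_def)
  ultimately have "X = Omega P x u v * A \<and> Y = Omega P x u v * B \<and> Z = Omega P x u v * C"
    unfolding Omega_def A_def[symmetric] B_def[symmetric] C_def[symmetric]
      X_def[symmetric] Y_def[symmetric] Z_def[symmetric]
    by (auto simp: field_simps)
  then show ?thesis
    using cyc by (auto simp: cyclic3_def A_def B_def C_def X_def Y_def Z_def)
qed

locale surface_chart =
  fixes P :: "pt3 \<Rightarrow> complex" and U :: "pt3 set"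
    and phi :: "pt2 \<Rightarrow> pt3" and V :: "pt2 set" and p :: pt3
  assumes holo: "holo3 P" and chart: "hol_chart U phi V p" and surface: "U \<subseteq> surf P"
    and regular: "x \<in> U \<Longrightarrow> \<exists>l\<in>{1, 2, 3}. pdP P l x \<noteq> 0"
begin

definition coord_fun :: "nat \<Rightarrow> pt2 \<Rightarrow> complex" where
  "coord_fun i z = coord i (phi z)"

lemma open_V: "open V"
  using chart by (simp add: hol_chart_def)

lemma phi_in_U: "z \<in> V \<Longrightarrow> phi z \<in> U"
  using chart by (auto simp: hol_chart_def)

lemma obtain_preimage: obtains z where "z \<in> V" "phi z = p"
  using chart by (auto simp: hol_chart_def)

lemma holo2_coord_fun: "i \<in> {1, 2, 3} \<Longrightarrow> holo2 (coord_fun i) V"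
  using chart by (auto simp: hol_chart_def coord_fun_def[abs_def])

lemma coord_dvec: "i \<in> {1, 2, 3} \<Longrightarrow> coord i (dvec a phi z) = d2 a (coord_fun i) z"
  by (auto simp: dvec_def coord_fun_def[abs_def])

lemma has_d2_holo3_comp:
  assumes "holo3 Q" and z: "z \<in> V"
  shows "has_d2 (\<lambda>z. Q (phi z)) (\<Sum>k\<in>{1, 2, 3}. pdP Q k (phi z) * d2 1 (coord_fun k) z)
    (\<Sum>k\<in>{1, 2, 3}. pdP Q k (phi z) * d2 2 (coord_fun k) z) z"
proof -
  let ?f = coord_fun
  have phi: "phi = (\<lambda>z. (?f 1 z, ?f 2 z, ?f 3 z))"
    by (simp add: coord_fun_def)
  have f: "(?f i has_derivative (\<lambda>v. d2 1 (?f i) z * fst v + d2 2 (?f i) z * snd v)) (at z)"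
    if "i \<in> {1, 2, 3}" for i
    using holo2_has_d2[OF holo2_coord_fun[OF that] z] by (simp add: has_d2_def)
  have "(phi has_derivative (\<lambda>v. (d2 1 (?f 1) z * fst v + d2 2 (?f 1) z * snd v,
      d2 1 (?f 2) z * fst v + d2 2 (?f 2) z * snd v,
      d2 1 (?f 3) z * fst v + d2 2 (?f 3) z * snd v))) (at z)"
    by (subst phi) (intro has_derivative_Pair f; simp)
  from has_derivative_compose[OF this assms(1)[unfolded holo3_def, rule_format]] show ?thesis
    by (simp add: has_d2_def algebra_simps)
qed

lemma tangent_dvec:
  assumes "z \<in> V" "a \<in> {1, 2}"
  shows "(\<Sum>k\<in>{1, 2, 3}. pdP P k (phi z) * coord k (dvec a phi z)) = 0"
proof -
  have "P (phi z) = 0" if "z \<in> V" for z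
    using phi_in_U[OF that] surface by (auto simp: surf_def)
  then have "has_d2 (\<lambda>z. P (phi z)) 0 0 z"
    by (intro has_d2_transform[OF has_d2_const[of 0] open_V assms(1)]) simp
  from has_d2_imp_d2[OF this] has_d2_imp_d2[OF has_d2_holo3_comp[OF holo assms(1)]] assms(2)
  show ?thesis by (auto simp: coord_dvec)
qed

lemma jacobian_coord_fun:
  assumes "cyclic3 i j k" and z: "z \<in> V"
  shows "jacobian (coord_fun i) (coord_fun j) z =
    Omega P (phi z) (dvec 1 phi z) (dvec 2 phi z) * pdP P k (phi z)"
proof -
  obtain l where "l \<in> {1, 2, 3}" "pdP P l (phi z) \<noteq> 0"
    using regular[OF phi_in_U[OF z]] by blast
  from cross_eq_Omega[OF assms(1) this, of "dvec 1 phi z" "dvec 2 phi z"] tangent_dvec[OF z]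
  show ?thesis
    using cyclic3_in[OF assms(1)] by (simp add: coord_dvec jacobian_def mult.commute)
qed

lemma Omega_dvec_nonzero:
  assumes z: "z \<in> V"
  shows "Omega P (phi z) (dvec 1 phi z) (dvec 2 phi z) \<noteq> 0"
proof
  let ?u = "dvec 1 phi z" and ?v = "dvec 2 phi z"
  have immersion: "c1 = 0 \<and> c2 = 0"
    if "\<forall>i\<in>{1, 2, 3}. c1 * coord i ?u + c2 * coord i ?v = 0" for c1 c2
    using chart z that unfolding hol_chart_def by blast
  assume "Omega P (phi z) ?u ?v = 0"
  then have "jacobian (coord_fun i) (coord_fun j) z = 0" if "cyclic3 i j k" for i j k
    using jacobian_coord_fun[OF that z] by simp
  then have minors: "coord i ?u * coord j ?v = coord j ?u * coord i ?v"
    if "i \<in> {1, 2, 3}" "j \<in> {1, 2, 3}" for i j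
    using that by (auto simp: cyclic3_def coord_dvec jacobian_def)
  have "coord i ?u = 0 \<and> coord i ?v = 0" if i: "i \<in> {1, 2, 3}" for i
    using immersion[of "coord i ?v" "- coord i ?u"] minors[OF i] by (simp add: mult.commute)
  then show False using immersion[of 1 1] by simp
qed

lemma jacobian_coord_fun_nonzero:
  "cyclic3 i j k \<Longrightarrow> z \<in> V \<Longrightarrow> pdP P k (phi z) \<noteq> 0 \<Longrightarrow> jacobian (coord_fun i) (coord_fun j) z \<noteq> 0"
  by (simp add: jacobian_coord_fun Omega_dvec_nonzero)

end

section \<open>Hess connections\<close>

lemma is_hess_conn_torsion_free:
  assumes "is_hess_conn P i j phi V Gam"
  shows "torsion_free_connection Gam V"
proof
  note hess = assms[unfolded is_hess_conn_def]
  show "holo2 (Gam c a b) V" if "a \<in> {1, 2}" "b \<in> {1, 2}" "c \<in> {1, 2}" for a b c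
    using hess[THEN conjunct1] that by blast
  show "Gam c a b y = Gam c b a y" if "a \<in> {1, 2}" "b \<in> {1, 2}" "c \<in> {1, 2}" "y \<in> V" for a b c y
    using hess[THEN conjunct2, THEN conjunct1] that by blast
qed

lemma is_hess_conn_d2_Omega:
  assumes "is_hess_conn P i j phi V Gam" "z \<in> V" "a \<in> {1, 2}"
  shows "d2 a (\<lambda>z. Omega P (phi z) (dvec 1 phi z) (dvec 2 phi z)) z
    = (\<Sum>c\<in>{1, 2}. Gam c a c z) * Omega P (phi z) (dvec 1 phi z) (dvec 2 phi z)"
proof -
  have "d2 a (\<lambda>z. Omega P (phi z) (dvec 1 phi z) (dvec 2 phi z)) z =
      (\<Sum>e\<in>{1, 2}. Gam e a 1 z * Omega P (phi z) (dvec e phi z) (dvec 2 phi z)) +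
      (\<Sum>e\<in>{1, 2}. Gam e a 2 z * Omega P (phi z) (dvec 1 phi z) (dvec e phi z))"
    using assms unfolding is_hess_conn_def by blast
  moreover have "Omega P x u u = 0" for x u
    by (simp add: Omega_def)
  ultimately show ?thesis by (simp add: algebra_simps)
qed

lemma is_hess_conn_ex_hessian_multiplier:
  assumes hess: "is_hess_conn P i j phi V Gam" and k: "k \<in> {i, j}" and z: "z \<in> V"
    and f: "f = (\<lambda>z. coord k (phi z))" "holo2 f V" "d2 1 f z \<noteq> 0 \<or> d2 2 f z \<noteq> 0"
  shows "\<exists>s. torsion_free_connection.hessian_multiplier Gam f s z"
proof -
  interpret torsion_free_connection Gam V
    using is_hess_conn_torsion_free[OF hess] .
  define Y where "Y n = (if n = 1 then (\<lambda>z. - d2 2 f z) else d2 1 f)" for n :: nat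
  have tangent: "tangent_fol phi k y v1 v2 \<longleftrightarrow> d2 1 f y * v1 + d2 2 f y * v2 = 0" for y v1 v2
    by (simp add: tangent_fol_def f(1))
  have "holo2 (Y 1) V \<and> holo2 (Y 2) V \<and> (\<forall>y\<in>V. tangent_fol phi k y (Y 1 y) (Y 2 y))"
    using f(2) by (simp add: Y_def tangent holo2_uminus holo2_d2)
  moreover have "\<forall>Y. holo2 (Y 1) V \<and> holo2 (Y 2) V \<and>
      (\<forall>y\<in>V. tangent_fol phi k y (Y 1 y) (Y 2 y)) \<longrightarrow>
      (\<forall>a\<in>{1, 2}. \<forall>y\<in>V. tangent_fol phi k y (cov_deriv Gam a Y 1 y) (cov_deriv Gam a Y 2 y))"
    using hess k unfolding is_hess_conn_def by blast
  ultimately have "tangent_fol phi k z (cov_deriv Gam a Y 1 z) (cov_deriv Gam a Y 2 z)"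
    if "a \<in> {1, 2}" for a
    using z that by blast
  moreover have "d2 1 f z * cov_deriv Gam a Y 1 z + d2 2 f z * cov_deriv Gam a Y 2 z
      = hessian f a 1 z * d2 2 f z - hessian f a 2 z * d2 1 f z" for a
    using d2_uminus[OF holo2_d2[OF f(2)] z, of a 2]
    by (simp add: cov_deriv_def Y_def hessian_def algebra_simps)
  ultimately show ?thesis
    using ex_hessian_multiplier[OF f(2) z _ f(3)] by (simp add: tangent)
qed

locale hess_chart = surface_chart +
  fixes i j k :: nat and Gam :: "nat \<Rightarrow> nat \<Rightarrow> nat \<Rightarrow> pt2 \<Rightarrow> complex"
  assumes cyclic: "cyclic3 i j k" and hess_conn: "is_hess_conn P i j phi V Gam"
    and holo3_pdP: "holo3 (pdP P k)" and transversal: "x \<in> U \<Longrightarrow> pdP P k x \<noteq> 0"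
begin

sublocale torsion_free_connection Gam V
  using hess_conn by (rule is_hess_conn_torsion_free)

definition density :: "pt2 \<Rightarrow> complex" where
  "density z = pdP P k (phi z)"

lemma holo2_coord_funs: "holo2 (coord_fun i) V" "holo2 (coord_fun j) V"
  using cyclic3_in[OF cyclic] by (simp_all add: holo2_coord_fun)

lemma holo2_density: "holo2 density V"
  unfolding density_def[abs_def] holo2_iff using open_V has_d2_holo3_comp[OF holo3_pdP] by blast

lemma density_nonzero: "z \<in> V \<Longrightarrow> density z \<noteq> 0"
  by (simp add: density_def transversal phi_in_U)

lemma jacobian_nonzero: "z \<in> V \<Longrightarrow> jacobian (coord_fun i) (coord_fun j) z \<noteq> 0"
  by (rule jacobian_coord_fun_nonzero[OF cyclic _ transversal[OF phi_in_U]])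

lemma ex_hessian_multipliers:
  assumes z: "z \<in> V"
  shows "\<exists>s t. hessian_multiplier (coord_fun i) s z \<and> hessian_multiplier (coord_fun j) t z"
  using is_hess_conn_ex_hessian_multiplier[OF hess_conn _ z _ holo2_coord_funs(1)]
    is_hess_conn_ex_hessian_multiplier[OF hess_conn _ z _ holo2_coord_funs(2)]
    jacobian_nonzero_imp_gradients_nonzero[OF jacobian_nonzero[OF z]]
  by (simp add: coord_fun_def[abs_def])

text \<open>The area form is \<open>dx\<^sub>i \<and> dx\<^sub>j\<close> divided by the density, and it is parallel.\<close>

lemma d2_density:
  assumes s: "hessian_multiplier (coord_fun i) s z" and t: "hessian_multiplier (coord_fun j) t z"
    and z: "z \<in> V" and a: "a \<in> {1, 2}"
  shows "d2 a density z = (s * d2 a (coord_fun i) z + t * d2 a (coord_fun j) z) * density z"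
proof -
  define J where "J = jacobian (coord_fun i) (coord_fun j)"
  define W where "W z = Omega P (phi z) (dvec 1 phi z) (dvec 2 phi z)" for z
  have J_eq: "J z = W z * density z" if "z \<in> V" for z
    using jacobian_coord_fun[OF cyclic that] by (simp add: J_def W_def density_def)
  have "holo2 J V"
    unfolding J_def using holo2_coord_funs by (rule holo2_jacobian)
  then have "holo2 (\<lambda>z. J z / density z) V"
    using holo2_density density_nonzero by (rule holo2_divide)
  then have W: "holo2 W V"
    by (rule holo2_cong) (simp add: J_eq density_nonzero)
  have "d2 a J z = d2 a W z * density z + W z * d2 a density z"
    using d2_cong[OF z holo2_mult[OF W holo2_density] J_eq] d2_mult[OF W holo2_density z] by simp
  moreover have "d2 a W z = (\<Sum>c\<in>{1, 2}. Gam c a c z) * W z"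
    using is_hess_conn_d2_Omega[OF hess_conn z a] by (simp add: W_def[abs_def])
  moreover have "d2 a J z = ((\<Sum>c\<in>{1, 2}. Gam c a c z) + s * d2 a (coord_fun i) z
      + t * d2 a (coord_fun j) z) * J z"
    unfolding J_def by (rule d2_jacobian[OF holo2_coord_funs(1) s holo2_coord_funs(2) t z a])
  ultimately have "W z * d2 a density z =
      W z * ((s * d2 a (coord_fun i) z + t * d2 a (coord_fun j) z) * density z)"
    unfolding J_eq[OF z] by (simp add: algebra_simps)
  then show ?thesis
    using Omega_dvec_nonzero[OF z] by (simp add: W_def)
qed

lemma flat_imp_mixed_log_density_square_zero:
  assumes flat and D: "holo2 D UNIV"
    and square: "\<And>z. z \<in> V \<Longrightarrow> D (coord_fun i z, coord_fun j z) = (density z)\<^sup>2"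
    and y: "y \<in> V"
  shows "mixed_log D (coord_fun i y, coord_fun j y) = 0"
proof -
  obtain s t where s: "\<And>z. z \<in> V \<Longrightarrow> hessian_multiplier (coord_fun i) (s z) z"
    and t: "\<And>z. z \<in> V \<Longrightarrow> hessian_multiplier (coord_fun j) (t z) z"
    using ex_hessian_multipliers by metis
  have dlog: "d2 a (\<lambda>z. D (coord_fun i z, coord_fun j z)) z = 2 * D (coord_fun i z, coord_fun j z)
      * (s z * d2 a (coord_fun i) z + t z * d2 a (coord_fun j) z)"
    if z: "z \<in> V" and a: "a \<in> {1, 2}" for z a
  proof -
    have "d2 a (\<lambda>z. D (coord_fun i z, coord_fun j z)) z = 2 * density z * d2 a density z"
      using d2_cong[OF z holo2_mult[OF holo2_density holo2_density]
          square[unfolded power2_eq_square]] d2_mult[OF holo2_density holo2_density z] by simp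
    also have "d2 a density z =
        (s z * d2 a (coord_fun i) z + t z * d2 a (coord_fun j) z) * density z"
      by (rule d2_density[OF s[OF z] t[OF z] z a])
    finally show ?thesis by (simp add: square[OF z] power2_eq_square)
  qed
  show ?thesis
    by (rule flat_imp_mixed_log_zero[OF \<open>flat\<close> holo2_coord_funs holo2_nonzero[OF D] y _ _
          jacobian_nonzero _ s dlog]) (simp_all add: square density_nonzero)
qed

end

lemma hess_flat_imp_mixed_log_zero:
  assumes cyc: "cyclic3 i j k" and P: "holo3 P" "holo3 (pdP P k)"
    and D: "holo2 D UNIV" "\<And>x. x \<in> surf P \<Longrightarrow> (pdP P k x)\<^sup>2 = D (coord i x, coord j x)"
    and hess_flat: "hess_flat P i j" and p: "p \<in> pair_region P i j"
  shows "mixed_log D (coord i p, coord j p) = 0"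
proof -
  obtain phi V Gam where chart: "hol_chart (pair_region P i j) phi V p"
    and hess_conn: "is_hess_conn P i j phi V Gam"
    and curv: "\<forall>y\<in>V. \<forall>a\<in>{1,2}. \<forall>b\<in>{1,2}. \<forall>c\<in>{1,2}. \<forall>d\<in>{1,2}. curv Gam d c a b y = 0"
    using bspec[OF hess_flat[unfolded hess_flat_def] p] by blast
  interpret hess_chart P "pair_region P i j" phi V p i j k Gam
    using P chart hess_conn cyc cyclic3_in[OF cyc]
    by unfold_locales (auto simp: pair_region_cyclic[OF cyc])
  obtain y where y: "y \<in> V" "phi y = p" by (rule obtain_preimage)
  have flat using curv by (simp add: flat_def)
  moreover have "D (coord_fun i z, coord_fun j z) = (density z)\<^sup>2" if "z \<in> V" for z
    using D(2)[of "phi z"] phi_in_U[OF that] surface by (auto simp: coord_fun_def density_def)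
  ultimately show ?thesis
    using flat_imp_mixed_log_density_square_zero[OF _ D(1) _ y(1)] y(2) by (simp add: coord_fun_def)
qed

section \<open>Parallelizable webs\<close>

definition dir_deriv :: "pt2 \<Rightarrow> (pt2 \<Rightarrow> complex) \<Rightarrow> pt2 \<Rightarrow> complex" where
  "dir_deriv v f z = fst v * d2 1 f z + snd v * d2 2 f z"

lemma holo2_dir_deriv: "holo2 f V \<Longrightarrow> holo2 (dir_deriv v f) V"
  unfolding dir_deriv_def[abs_def]
  by (intro holo2_add holo2_mult holo2_const holo2_d2) (simp_all add: holo2_open)

lemma d2_dir_deriv:
  assumes f: "holo2 f V" and z: "z \<in> V"
  shows "d2 a (dir_deriv v f) z = dir_deriv v (d2 a f) z"
proof -
  have h: "holo2 (d2 b f) V" "holo2 (\<lambda>z. c) V" for b c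
    using f by (simp_all add: holo2_d2 holo2_const holo2_open)
  show ?thesis
    unfolding dir_deriv_def[abs_def] d2_add[OF holo2_mult[OF h(2,1)] holo2_mult[OF h(2,1)] z]
      d2_mult[OF h(2,1) z] d2_const
    using d2_commute[OF f z] by simp
qed

lemma dir_deriv_zero_imp_jacobian_zero:
  assumes "v \<noteq> 0" "dir_deriv v f z = 0" "dir_deriv v g z = 0"
  shows "jacobian f g z = 0"
proof -
  have "fst v * jacobian f g z = 0" "snd v * jacobian f g z = 0"
    using assms(2,3) unfolding dir_deriv_def jacobian_def by algebra+
  then show ?thesis using \<open>v \<noteq> 0\<close> by (auto simp: prod_eq_iff)
qed

lemma trivial_connection:
  assumes "open V"
  shows "torsion_free_connection (\<lambda>_ _ _ _. 0) V"
    and "torsion_free_connection.flat (\<lambda>_ _ _ _. 0) V"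
proof -
  show "torsion_free_connection (\<lambda>_ _ _ _. 0) V"
    using assms by unfold_locales (simp_all add: holo2_const)
  then interpret torsion_free_connection "\<lambda>_ _ _ _. 0" V .
  show flat by (simp add: flat_def curv_def d2_const)
qed

lemma parallel_leaves_imp_ex_hessian_multiplier:
  assumes f: "holo2 f V" and z: "z \<in> V" and nz: "d2 1 f z \<noteq> 0 \<or> d2 2 f z \<noteq> 0"
    and v: "v \<noteq> 0" "\<And>z. z \<in> V \<Longrightarrow> dir_deriv v f z = 0"
  shows "\<exists>s. torsion_free_connection.hessian_multiplier (\<lambda>_ _ _ _. 0) f s z"
proof -
  interpret torsion_free_connection "\<lambda>_ _ _ _. 0" V
    using holo2_open[OF f] by (rule trivial_connection)
  have "d2 a (dir_deriv v f) z = 0" for a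
    using d2_cong[OF z holo2_const[OF holo2_open[OF f]] v(2)] by (simp add: d2_const)
  then have "jacobian (d2 a f) f z = 0" for a
    using dir_deriv_zero_imp_jacobian_zero[OF v(1) _ v(2)[OF z]] d2_dir_deriv[OF f z] by metis
  then have "hessian f a 1 z * d2 2 f z = hessian f a 2 z * d2 1 f z" for a
    by (simp add: hessian_def jacobian_def d2_commute[OF f z, of a 1] d2_commute[OF f z, of a 2])
  then show ?thesis
    by (intro ex_hessian_multiplier[OF f z _ nz])
qed

lemma d2_dir_deriv_hessian_multiplier:
  assumes f: "holo2 f V" and z: "z \<in> V" and a: "a \<in> {1, 2}"
    and s: "torsion_free_connection.hessian_multiplier (\<lambda>_ _ _ _. 0) f s z"
  shows "d2 a (dir_deriv v f) z = s * d2 a f z * dir_deriv v f z"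
proof -
  interpret torsion_free_connection "\<lambda>_ _ _ _. 0" V
    using holo2_open[OF f] by (rule trivial_connection)
  have "d2 b (d2 a f) z = s * (d2 b f z * d2 a f z)" if "b \<in> {1, 2}" for b
  proof -
    have "hessian f b a z = s * (d2 b f z * d2 a f z)"
      using s a that unfolding hessian_multiplier_def by blast
    then show ?thesis by (simp add: hessian_def)
  qed
  then show ?thesis
    by (simp add: d2_dir_deriv[OF f z]) (simp add: dir_deriv_def algebra_simps)
qed

lemma d2_dir_deriv_ratio:
  assumes f: "holo2 f V" "torsion_free_connection.hessian_multiplier (\<lambda>_ _ _ _. 0) f s z"
    and g: "holo2 g V" "torsion_free_connection.hessian_multiplier (\<lambda>_ _ _ _. 0) g t z"
    and z: "z \<in> V" and a: "a \<in> {1, 2}" and nz: "dir_deriv v g z \<noteq> 0"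
  shows "d2 a (\<lambda>z. dir_deriv v f z / dir_deriv v g z) z =
    dir_deriv v f z / dir_deriv v g z * (s * d2 a f z - t * d2 a g z)"
  unfolding d2_divide[OF holo2_dir_deriv[OF f(1)] holo2_dir_deriv[OF g(1)] z nz]
    d2_dir_deriv_hessian_multiplier[OF f(1) z a f(2)]
    d2_dir_deriv_hessian_multiplier[OF g(1) z a g(2)]
  using nz by (simp add: field_simps power2_eq_square)

lemma web_locally_parallelizableE:
  assumes "web_locally_parallelizable P" "p \<in> web_region P"
  obtains phi V where "hol_chart (web_region P) phi V p"
    "\<And>i. i \<in> {1, 2, 3} \<Longrightarrow> \<exists>v. v \<noteq> 0 \<and> (\<forall>z\<in>V. dir_deriv v (\<lambda>z. coord i (phi z)) z = 0)"
proof -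
  obtain phi V where chart: "hol_chart (web_region P) phi V p"
    and fol: "\<forall>i\<in>{1, 2, 3}. \<exists>c1 c2. (c1, c2) \<noteq> (0, 0) \<and> (\<forall>z\<in>V. \<forall>v1 v2.
      d2 1 (\<lambda>z. coord i (phi z)) z * v1 + d2 2 (\<lambda>z. coord i (phi z)) z * v2 = 0
      \<longleftrightarrow> c1 * v1 + c2 * v2 = 0)"
    using bspec[OF assms(1)[unfolded web_locally_parallelizable_def] assms(2)] by blast
  show thesis
  proof (rule that[OF chart])
    fix i :: nat assume "i \<in> {1, 2, 3}"
    then obtain c1 c2 where c: "(c1, c2) \<noteq> (0, 0)" "\<forall>z\<in>V. \<forall>v1 v2.
      d2 1 (\<lambda>z. coord i (phi z)) z * v1 + d2 2 (\<lambda>z. coord i (phi z)) z * v2 = 0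
      \<longleftrightarrow> c1 * v1 + c2 * v2 = 0"
      using fol by blast
    have "dir_deriv (c2, - c1) (\<lambda>z. coord i (phi z)) z = 0" if "z \<in> V" for z
    proof -
      have "c1 * c2 + c2 * (- c1) = 0" by simp
      then have "d2 1 (\<lambda>z. coord i (phi z)) z * c2 + d2 2 (\<lambda>z. coord i (phi z)) z * (- c1) = 0"
        using c(2) that by blast
      then show ?thesis by (simp add: dir_deriv_def mult.commute)
    qed
    moreover have "(c2, - c1) \<noteq> 0" using c(1) by (auto simp: zero_prod_def)
    ultimately show "\<exists>v. v \<noteq> 0 \<and> (\<forall>z\<in>V. dir_deriv v (\<lambda>z. coord i (phi z)) z = 0)"
      by blast
  qed
qed

locale parallel_web_chart = surface_chart +
  fixes i j k :: nat
  assumes cyclic: "cyclic3 i j k"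
    and transversal: "x \<in> U \<Longrightarrow> l \<in> {1, 2, 3} \<Longrightarrow> pdP P l x \<noteq> 0"
    and parallel: "l \<in> {1, 2, 3} \<Longrightarrow> \<exists>v. v \<noteq> 0 \<and> (\<forall>z\<in>V. dir_deriv v (coord_fun l) z = 0)"
begin

sublocale torsion_free_connection "\<lambda>_ _ _ _. 0" V
  using open_V by (rule trivial_connection)

lemma index_in: "i \<in> {1, 2, 3}" "j \<in> {1, 2, 3}" "k \<in> {1, 2, 3}"
  using cyclic3_in[OF cyclic] by auto

lemma jacobian_nonzero: "z \<in> V \<Longrightarrow> jacobian (coord_fun i) (coord_fun j) z \<noteq> 0"
  by (rule jacobian_coord_fun_nonzero[OF cyclic _ transversal[OF phi_in_U index_in(3)]])

lemma ex_hessian_multipliers: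
  assumes z: "z \<in> V"
  shows "\<exists>s t. hessian_multiplier (coord_fun i) s z \<and> hessian_multiplier (coord_fun j) t z"
proof -
  have "\<exists>s. hessian_multiplier (coord_fun l) s z"
    if "l \<in> {1, 2, 3}" "d2 1 (coord_fun l) z \<noteq> 0 \<or> d2 2 (coord_fun l) z \<noteq> 0" for l
    using parallel[OF that(1)]
      parallel_leaves_imp_ex_hessian_multiplier[OF holo2_coord_fun[OF that(1)] z that(2)] by blast
  from this[OF index_in(1)] this[OF index_in(2)] show ?thesis
    using jacobian_nonzero_imp_gradients_nonzero[OF jacobian_nonzero[OF z]] by blast
qed

lemma dir_deriv_along_third_leaf:
  assumes z: "z \<in> V" and v: "v \<noteq> 0" "dir_deriv v (coord_fun k) z = 0"
  shows "dir_deriv v (coord_fun j) z \<noteq> 0"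
    and "pdP P j (phi z) / pdP P i (phi z) =
      - (dir_deriv v (coord_fun i) z / dir_deriv v (coord_fun j) z)"
proof -
  define A B \<alpha> \<beta> where "A = pdP P i (phi z)" and "B = pdP P j (phi z)"
    and "\<alpha> = dir_deriv v (coord_fun i) z" and "\<beta> = dir_deriv v (coord_fun j) z"
  have AB: "A \<noteq> 0" "B \<noteq> 0"
    unfolding A_def B_def using transversal[OF phi_in_U[OF z]] index_in by blast+
  have "A * d2 a (coord_fun i) z + B * d2 a (coord_fun j) z
      + pdP P k (phi z) * d2 a (coord_fun k) z = 0" if "a \<in> {1, 2}" for a
    using tangent_dvec[OF z that] cyclic
    by (auto simp: A_def B_def cyclic3_def coord_dvec algebra_simps)
  from this[of 1] this[of 2] have tangent: "A * \<alpha> + B * \<beta> = 0"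
    using v(2) unfolding \<alpha>_def \<beta>_def dir_deriv_def by simp algebra
  have "\<beta> \<noteq> 0"
  proof
    assume "\<beta> = 0"
    with tangent AB have "\<alpha> = 0" by simp
    with \<open>\<beta> = 0\<close> show False
      using dir_deriv_zero_imp_jacobian_zero[OF v(1)] jacobian_nonzero[OF z]
      unfolding \<alpha>_def \<beta>_def by blast
  qed
  then show "dir_deriv v (coord_fun j) z \<noteq> 0" by (simp add: \<beta>_def)
  have "B / A = - (\<alpha> / \<beta>)"
    using tangent AB(1) \<open>\<beta> \<noteq> 0\<close> by (simp add: field_simps eq_neg_iff_add_eq_0)
  then show "pdP P j (phi z) / pdP P i (phi z) =
      - (dir_deriv v (coord_fun i) z / dir_deriv v (coord_fun j) z)"
    by (simp add: A_def B_def \<alpha>_def \<beta>_def)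
qed

lemma mixed_log_slope_zero:
  assumes Q: "holo2 Q W"
    and slope: "\<And>z. z \<in> V \<Longrightarrow> (coord_fun i z, coord_fun j z) \<in> W \<and>
      Q (coord_fun i z, coord_fun j z) = pdP P j (phi z) / pdP P i (phi z)"
    and y: "y \<in> V"
  shows "mixed_log Q (coord_fun i y, coord_fun j y) = 0"
proof -
  define f g where "f = coord_fun i" and "g = coord_fun j"
  have f: "holo2 f V" and g: "holo2 g V"
    using index_in by (simp_all add: f_def g_def holo2_coord_fun)
  obtain s t where s: "\<And>z. z \<in> V \<Longrightarrow> hessian_multiplier f (s z) z"
    and t: "\<And>z. z \<in> V \<Longrightarrow> hessian_multiplier g (t z) z"
    using ex_hessian_multipliers unfolding f_def g_def by metis
  obtain v where v: "v \<noteq> 0" "\<And>z. z \<in> V \<Longrightarrow> dir_deriv v (coord_fun k) z = 0"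
    using parallel[OF index_in(3)] by blast
  let ?r = "\<lambda>z. dir_deriv v f z / dir_deriv v g z"
  have g_nz: "dir_deriv v g z \<noteq> 0" and Q_eq: "Q (f z, g z) = - ?r z" if z: "z \<in> V" for z
    using dir_deriv_along_third_leaf[OF z v(1) v(2)[OF z]] slope[OF z]
    by (simp_all add: f_def g_def)
  have Q_nz: "Q (f z, g z) \<noteq> 0" if z: "z \<in> V" for z
    using slope[OF z] transversal[OF phi_in_U[OF z]] index_in unfolding f_def g_def by simp
  have r: "holo2 ?r V"
    using f g g_nz by (intro holo2_divide holo2_dir_deriv)
  have dlog: "d2 a (\<lambda>z. Q (f z, g z)) z = 1 * Q (f z, g z) * (s z * d2 a f z + (- t z) * d2 a g z)"
    if z: "z \<in> V" and a: "a \<in> {1, 2}" for z a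
    using d2_cong[OF z holo2_uminus[OF r] Q_eq] d2_uminus[OF r z]
      d2_dir_deriv_ratio[OF f s[OF z] g t[OF z] z a g_nz[OF z]]
    by (simp add: Q_eq[OF z])
  show ?thesis
    unfolding f_def[symmetric] g_def[symmetric]
    by (rule flat_imp_mixed_log_zero[OF trivial_connection(2)[OF open_V] f g holo2_nonzero[OF Q] y
          _ _ jacobian_nonzero[folded f_def g_def] _ s dlog])
      (use slope Q_nz in \<open>simp_all add: f_def g_def\<close>)
qed

end

lemma web_parallelizable_imp_mixed_log_slope_zero:
  assumes cyc: "cyclic3 i j k" and P: "holo3 P" and Q: "holo2 Q W"
    and slope: "\<And>x. x \<in> web_region P \<Longrightarrow>
      (coord i x, coord j x) \<in> W \<and> Q (coord i x, coord j x) = pdP P j x / pdP P i x"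
    and web: "web_locally_parallelizable P" and p: "p \<in> web_region P"
  shows "mixed_log Q (coord i p, coord j p) = 0"
proof -
  obtain phi V where chart: "hol_chart (web_region P) phi V p"
    and par: "\<And>i. i \<in> {1, 2, 3} \<Longrightarrow> \<exists>v. v \<noteq> 0 \<and> (\<forall>z\<in>V. dir_deriv v (\<lambda>z. coord i (phi z)) z = 0)"
    using web_locally_parallelizableE[OF web p] by blast
  interpret surface_chart P "web_region P" phi V p
    using P chart by unfold_locales (auto simp: web_region_def)
  interpret parallel_web_chart P "web_region P" phi V p i j k
  proof
    show "pdP P l x \<noteq> 0" if "x \<in> web_region P" "l \<in> {1, 2, 3}" for x l
      using that unfolding web_region_def by blast
  qed (use cyc par in \<open>simp_all add: coord_fun_def[abs_def]\<close>)
  obtain y where y: "y \<in> V" "phi y = p" by (rule obtain_preimage)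
  show ?thesis
    using mixed_log_slope_zero[OF Q _ y(1)] slope[OF phi_in_U] y(2) by (simp add: coord_fun_def)
qed

section \<open>Parallelizing coordinates\<close>

definition flow_box ::
  "(complex \<Rightarrow> complex) \<Rightarrow> complex set \<Rightarrow> (complex \<Rightarrow> complex) \<Rightarrow> (complex \<Rightarrow> complex) \<Rightarrow> bool" where
  "flow_box r U T \<xi> \<longleftrightarrow> open U \<and> open (T ` U) \<and> continuous_on U T \<and> (\<forall>x\<in>U. \<xi> (T x) = x) \<and>
    (\<forall>t\<in>T ` U. (\<xi> has_field_derivative r (\<xi> t)) (at t))"

lemma holomorphic_local_inverse:
  assumes T: "T holomorphic_on S" and S: "open S" "x0 \<in> S" and "deriv T x0 \<noteq> 0"
  obtains U \<xi> where "open U" "x0 \<in> U" "U \<subseteq> S" "open (T ` U)"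
    "\<And>x. x \<in> U \<Longrightarrow> \<xi> (T x) = x"
    "\<And>x. x \<in> U \<Longrightarrow> (\<xi> has_field_derivative inverse (deriv T x)) (at (T x))"
proof -
  obtain \<delta> where \<delta>: "\<delta> > 0" "ball x0 \<delta> \<subseteq> S" and inj: "inj_on T (ball x0 \<delta>)"
    using has_complex_derivative_locally_injective[OF T S(2,1) assms(4)] by blast
  let ?U = "ball x0 \<delta>"
  have T': "T holomorphic_on ?U" using T \<delta>(2) by (rule holomorphic_on_subset)
  have image: "open (T ` ?U)" by (rule open_mapping_thm3[OF T' open_ball inj])
  obtain \<xi> where \<xi>: "\<xi> holomorphic_on T ` ?U"
    "\<And>x. x \<in> ?U \<Longrightarrow> deriv T x * deriv \<xi> (T x) = 1" "\<And>x. x \<in> ?U \<Longrightarrow> \<xi> (T x) = x"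
    using holomorphic_has_inverse[OF T' open_ball inj] by metis
  have "(\<xi> has_field_derivative inverse (deriv T x)) (at (T x))" if x: "x \<in> ?U" for x
    using holomorphic_derivI[OF \<xi>(1) image imageI[OF x]] inverse_unique[OF \<xi>(2)[OF x]] by simp
  then show thesis
    using that[of ?U \<xi>] \<delta> image \<xi>(3) by simp
qed

lemma flow_box_exists:
  assumes r: "r holomorphic_on S" and S: "open S" "x0 \<in> S" and "r x0 \<noteq> 0"
  obtains U T \<xi> where "flow_box r U T \<xi>" "x0 \<in> U" "U \<subseteq> S"
proof -
  have "open (S \<inter> r -` (- {0}))"
    using holomorphic_on_imp_continuous_on[OF r] S(1)
    by (rule continuous_open_preimage) (intro open_Compl closed_singleton)
  then obtain e where e: "e > 0" "ball x0 e \<subseteq> S \<inter> r -` (- {0})"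
    using S(2) \<open>r x0 \<noteq> 0\<close> by (auto elim: openE)
  have "(\<lambda>x. 1 / r x) holomorphic_on ball x0 e"
    using e by (intro holomorphic_intros holomorphic_on_subset[OF r]) auto
  then obtain T where "\<And>x. x \<in> ball x0 e \<Longrightarrow> (T has_field_derivative 1 / r x) (at x within ball x0 e)"
    using holomorphic_convex_primitive'[of "ball x0 e"] by auto
  then have T: "(T has_field_derivative 1 / r x) (at x)" if "x \<in> ball x0 e" for x
    using that by (metis at_within_open open_ball)
  have T_hol: "T holomorphic_on ball x0 e"
    unfolding holomorphic_on_open[OF open_ball] using T by blast
  have "deriv T x0 \<noteq> 0"
    using T[of x0] e \<open>r x0 \<noteq> 0\<close> by (simp add: DERIV_imp_deriv)
  then obtain U \<xi> where U: "open U" "x0 \<in> U" "U \<subseteq> ball x0 e" "open (T ` U)"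
    and \<xi>: "\<And>x. x \<in> U \<Longrightarrow> \<xi> (T x) = x"
    and d\<xi>: "\<And>x. x \<in> U \<Longrightarrow> (\<xi> has_field_derivative inverse (deriv T x)) (at (T x))"
    using holomorphic_local_inverse[OF T_hol open_ball, of x0] e(1) by auto
  have "inverse (deriv T x) = r (\<xi> (T x))" if "x \<in> U" for x
    using DERIV_imp_deriv[OF T[OF subsetD[OF U(3) that]]] \<xi>[OF that] by simp
  then have "flow_box r U T \<xi>"
    using U \<xi> d\<xi> continuous_on_subset[OF holomorphic_on_imp_continuous_on[OF T_hol] U(3)]
    by (auto simp: flow_box_def)
  then show thesis
    using that[of U T \<xi>] U(2,3) e(2) by auto
qed

definition graph3 :: "(pt2 \<Rightarrow> complex) \<Rightarrow> pt2 \<Rightarrow> pt3" where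
  "graph3 h w = (fst w, snd w, h w)"

locale flow_chart =
  fixes h :: "pt2 \<Rightarrow> complex" and S :: "pt2 set" and r q :: "complex \<Rightarrow> complex"
    and U1 U2 :: "complex set" and T1 T2 \<xi> \<eta> :: "complex \<Rightarrow> complex"
  assumes h: "holo2 h S" and sub: "U1 \<times> U2 \<subseteq> S"
    and box1: "flow_box r U1 T1 \<xi>" and box2: "flow_box q U2 T2 \<eta>"
begin

definition time_domain :: "pt2 set" where
  "time_domain = T1 ` U1 \<times> T2 ` U2"

definition flow :: "pt2 \<Rightarrow> pt2" where
  "flow t = (\<xi> (fst t), \<eta> (snd t))"

lemma open_time_domain: "open time_domain"
  using box1 box2 by (simp add: time_domain_def flow_box_def open_Times)

lemma flow_inverse: "w \<in> U1 \<times> U2 \<Longrightarrow> flow (map_prod T1 T2 w) = w"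
  using box1 box2 by (auto simp: flow_def flow_box_def)

lemma time_domain_eq: "time_domain = map_prod T1 T2 ` (U1 \<times> U2)"
  by (auto simp: time_domain_def)

lemma inverse_flow: "t \<in> time_domain \<Longrightarrow> map_prod T1 T2 (flow t) = t"
  using flow_inverse by (auto simp: time_domain_eq)

lemma flow_image: "flow ` time_domain = U1 \<times> U2"
  using flow_inverse by (force simp: time_domain_eq image_image)

lemma flow_in: "t \<in> time_domain \<Longrightarrow> flow t \<in> U1 \<times> U2"
  using flow_image by blast

lemma flow_in_S: "t \<in> time_domain \<Longrightarrow> flow t \<in> S"
  using flow_in sub by blast

lemma has_d2_flow:
  assumes t: "t \<in> time_domain"
  shows "has_d2 (\<lambda>t. fst (flow t)) (r (fst (flow t))) 0 t"
    and "has_d2 (\<lambda>t. snd (flow t)) 0 (q (snd (flow t))) t"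
    and "has_d2 (\<lambda>t. h (flow t))
      (d2 1 h (flow t) * r (fst (flow t))) (d2 2 h (flow t) * q (snd (flow t))) t"
proof -
  have "(\<xi> has_field_derivative r (\<xi> (fst t))) (at (fst t))"
    "(\<eta> has_field_derivative q (\<eta> (snd t))) (at (snd t))"
    using t box1 box2 by (auto simp: time_domain_def flow_box_def)
  from has_d2_DERIV[OF this(1) has_d2_fst] has_d2_DERIV[OF this(2) has_d2_snd]
  show d: "has_d2 (\<lambda>t. fst (flow t)) (r (fst (flow t))) 0 t"
    "has_d2 (\<lambda>t. snd (flow t)) 0 (q (snd (flow t))) t"
    by (simp_all add: flow_def)
  have "has_d2 h (d2 1 h (flow t)) (d2 2 h (flow t)) (fst (flow t), snd (flow t))"
    using holo2_has_d2[OF h flow_in_S[OF t]] by simp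
  from has_d2_Pair[OF this d]
  show "has_d2 (\<lambda>t. h (flow t))
      (d2 1 h (flow t) * r (fst (flow t))) (d2 2 h (flow t) * q (snd (flow t))) t"
    by simp
qed

lemma d2_graph3_flow:
  assumes "t \<in> time_domain"
  shows "d2 1 (\<lambda>t. fst (graph3 h (flow t))) t = r (fst (flow t))"
    "d2 2 (\<lambda>t. fst (graph3 h (flow t))) t = 0"
    "d2 1 (\<lambda>t. fst (snd (graph3 h (flow t)))) t = 0"
    "d2 2 (\<lambda>t. fst (snd (graph3 h (flow t)))) t = q (snd (flow t))"
    "d2 1 (\<lambda>t. snd (snd (graph3 h (flow t)))) t = d2 1 h (flow t) * r (fst (flow t))"
    "d2 2 (\<lambda>t. snd (snd (graph3 h (flow t)))) t = d2 2 h (flow t) * q (snd (flow t))"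
  using has_d2_flow[OF assms, THEN has_d2_imp_d2(1)] has_d2_flow[OF assms, THEN has_d2_imp_d2(2)]
  by (simp_all add: graph3_def)

lemma graph3_flow_image:
  "(\<lambda>t. graph3 h (flow t)) ` time_domain = graph3 h ` S \<inter> {x. (fst x, fst (snd x)) \<in> U1 \<times> U2}"
proof -
  have "(\<lambda>t. graph3 h (flow t)) ` time_domain = graph3 h ` (U1 \<times> U2)"
    using flow_image by (simp add: image_image[symmetric])
  then show ?thesis using sub by (auto simp: graph3_def)
qed

lemma graph3_flow_homeomorphism:
  defines "phi \<equiv> \<lambda>t. graph3 h (flow t)"
  shows "openin (top_of_set (graph3 h ` S)) (phi ` time_domain)"
    and "inj_on phi time_domain"
    and "continuous_on (phi ` time_domain) (the_inv_into time_domain phi)"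
proof -
  let ?inv = "\<lambda>x :: pt3. map_prod T1 T2 (fst x, fst (snd x))"
  note image = graph3_flow_image[folded phi_def]
  have inv: "?inv (phi t) = t" if "t \<in> time_domain" for t
    using inverse_flow[OF that] by (simp add: phi_def graph3_def)
  have "{x :: pt3. (fst x, fst (snd x)) \<in> U1 \<times> U2} = U1 \<times> U2 \<times> UNIV" by auto
  then have "open {x :: pt3. (fst x, fst (snd x)) \<in> U1 \<times> U2}"
    using box1 box2 by (simp add: flow_box_def open_Times)
  then show "openin (top_of_set (graph3 h ` S)) (phi ` time_domain)"
    unfolding image by (rule openin_open_Int)
  show inj: "inj_on phi time_domain"
    by (rule inj_on_inverseI[of _ ?inv]) (rule inv)
  have "continuous_on U1 T1" "continuous_on U2 T2"
    using box1 box2 by (simp_all add: flow_box_def)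
  note [continuous_intros] = this[THEN continuous_on_compose2]
  have "continuous_on (phi ` time_domain) ?inv"
    unfolding image map_prod_def split_def by (intro continuous_intros) auto
  then show "continuous_on (phi ` time_domain) (the_inv_into time_domain phi)"
    by (rule continuous_on_eq) (use inv the_inv_into_f_f[OF inj] in auto)
qed

lemma hol_chart_graph3_flow:
  assumes nz: "\<And>w. w \<in> U1 \<times> U2 \<Longrightarrow> r (fst w) \<noteq> 0 \<and> q (snd w) \<noteq> 0" and w: "w \<in> U1 \<times> U2"
  shows "hol_chart (graph3 h ` S) (\<lambda>t. graph3 h (flow t)) time_domain (graph3 h w)"
  unfolding hol_chart_def
proof (intro conjI graph3_flow_homeomorphism open_time_domain)
  let ?phi = "\<lambda>t. graph3 h (flow t)"
  show "\<forall>i\<in>{1, 2, 3}. holo2 (\<lambda>t. coord i (?phi t)) time_domain"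
    using has_d2_flow by (auto simp: graph3_def holo2_iff open_time_domain) blast+
  show "?phi ` time_domain \<subseteq> graph3 h ` S"
    unfolding graph3_flow_image by blast
  show "graph3 h w \<in> ?phi ` time_domain"
    unfolding graph3_flow_image using w sub by (auto simp: graph3_def)
  show "\<forall>t\<in>time_domain. \<forall>c1 c2.
      (\<forall>i\<in>{1, 2, 3}. c1 * coord i (dvec 1 ?phi t) + c2 * coord i (dvec 2 ?phi t) = 0)
      \<longrightarrow> c1 = 0 \<and> c2 = 0"
  proof (intro ballI allI impI)
    fix t c1 c2 assume t: "t \<in> time_domain"
      and "\<forall>i\<in>{1, 2, 3}. c1 * coord i (dvec 1 ?phi t) + c2 * coord i (dvec 2 ?phi t) = 0"
    then show "c1 = 0 \<and> c2 = 0"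
      using nz[OF flow_in[OF t]] by (simp add: dvec_def d2_graph3_flow)
  qed
qed

end

text \<open>By the separation hypothesis, in the flow times of r and q the three foliations are those
  of the coordinates and of their sum.\<close>

lemma graph_web_locally_parallelizable:
  assumes region: "web_region P = graph3 h ` S" and h: "holo2 h S"
    and r: "r holomorphic_on UNIV" and q: "q holomorphic_on UNIV"
    and nz: "\<And>w. w \<in> S \<Longrightarrow> r (fst w) \<noteq> 0 \<and> q (snd w) \<noteq> 0 \<and> d2 1 h w \<noteq> 0"
    and separated: "\<And>w. w \<in> S \<Longrightarrow> d2 1 h w * r (fst w) = d2 2 h w * q (snd w)"
  shows "web_locally_parallelizable P"
  unfolding web_locally_parallelizable_def
proof
  fix p assume "p \<in> web_region P"
  then obtain x y where p: "p = graph3 h (x, y)" "(x, y) \<in> S"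
    by (auto simp: region)
  obtain S1 S2 where S: "open S1" "open S2" "(x, y) \<in> S1 \<times> S2" "S1 \<times> S2 \<subseteq> S"
    using open_prod_elim[OF holo2_open[OF h] p(2)] by blast
  obtain U1 T1 \<xi> where x: "flow_box r U1 T1 \<xi>" "x \<in> U1" "U1 \<subseteq> S1"
    using flow_box_exists[OF holomorphic_on_subset[OF r] S(1), of x] S(3) nz[OF p(2)] by auto
  obtain U2 T2 \<eta> where y: "flow_box q U2 T2 \<eta>" "y \<in> U2" "U2 \<subseteq> S2"
    using flow_box_exists[OF holomorphic_on_subset[OF q] S(2), of y] S(3) nz[OF p(2)] by auto
  interpret flow_chart h S r q U1 U2 T1 T2 \<xi> \<eta>
    using h x y S(4) by unfold_locales auto
  let ?phi = "\<lambda>t. graph3 h (flow t)"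
  have "hol_chart (web_region P) ?phi time_domain p"
    unfolding region p(1) using nz sub x(2) y(2) by (intro hol_chart_graph3_flow) auto
  moreover have "\<exists>c1 c2. (c1, c2) \<noteq> (0, 0) \<and> (\<forall>t\<in>time_domain. \<forall>v1 v2.
      d2 1 (\<lambda>t. coord i (?phi t)) t * v1 + d2 2 (\<lambda>t. coord i (?phi t)) t * v2 = 0
      \<longleftrightarrow> c1 * v1 + c2 * v2 = 0)"
    if "i \<in> {1, 2, 3}" for i
  proof (intro exI conjI ballI allI)
    show "(if i = 2 then 0 else 1, if i = 1 then 0 else 1) \<noteq> (0 :: complex, 0 :: complex)" by simp
    fix t v1 v2 assume t: "t \<in> time_domain"
    have "d2 2 h (flow t) * q (snd (flow t)) = d2 1 h (flow t) * r (fst (flow t))"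
      using separated[OF flow_in_S[OF t]] by simp
    with that nz[OF flow_in_S[OF t]]
    show "d2 1 (\<lambda>t. coord i (?phi t)) t * v1 + d2 2 (\<lambda>t. coord i (?phi t)) t * v2 = 0
        \<longleftrightarrow> (if i = 2 then 0 else 1) * v1 + (if i = 1 then 0 else 1) * v2 = 0"
      by (auto simp: d2_graph3_flow[OF t] simp flip: distrib_left)
  qed
  ultimately show "\<exists>phi V. hol_chart (web_region P) phi V p \<and>
      (\<forall>i\<in>{1,2,3}. \<exists>c1 c2. (c1, c2) \<noteq> (0, 0) \<and> (\<forall>y\<in>V. \<forall>v1 v2.
        d2 1 (\<lambda>z. coord i (phi z)) y * v1 + d2 2 (\<lambda>z. coord i (phi z)) y * v2 = 0
        \<longleftrightarrow> c1 * v1 + c2 * v2 = 0))"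
    by blast
qed

section \<open>Cubic surfaces\<close>

lemma complex_quadratic_root:
  fixes p q r :: complex
  assumes "p \<noteq> 0 \<or> q \<noteq> 0"
  obtains y where "p * y\<^sup>2 + q * y + r = 0"
proof (cases "p = 0")
  case True
  then show ?thesis using assms by (intro that[of "- r / q"]) auto
next
  case False
  define y where "y = (csqrt (q\<^sup>2 - 4 * p * r) - q) / (2 * p)"
  have "2 * p * y + q = csqrt (q\<^sup>2 - 4 * p * r)"
    using False by (simp add: y_def)
  then have "(2 * p * y + q)\<^sup>2 = q\<^sup>2 - 4 * p * r" by simp
  then have "4 * p * (p * y\<^sup>2 + q * y + r) = 0" by algebra
  then show ?thesis using False that by auto
qed

locale cubic =
  fixes c e1 e2 a b d :: complex
begin

definition cub :: "pt3 \<Rightarrow> complex" where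
  "cub = (\<lambda>(x, y, z). x * y * z - c * z + e1 * x\<^sup>2 + e2 * y\<^sup>2 + a * x + b * y + d)"

lemma pdP_cub:
  "pdP cub 1 = (\<lambda>p. fst (snd p) * snd (snd p) + 2 * e1 * fst p + a)"
  "pdP cub 2 = (\<lambda>p. fst p * snd (snd p) + 2 * e2 * fst (snd p) + b)"
  "pdP cub 3 = (\<lambda>p. fst p * fst (snd p) - c)"
  and holo3_cub: "holo3 cub"
proof -
  define A where "A k p = (if k = 1 then fst (snd p) * snd (snd p) + 2 * e1 * fst p + a
    else if k = 2 then fst p * snd (snd p) + 2 * e2 * fst (snd p) + b else fst p * fst (snd p) - c)"
    for k :: nat and p :: pt3
  have deriv: "(cub has_derivative (\<lambda>v. \<Sum>k\<in>{1, 2, 3}. A k p * coord k v)) (at p)" for p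
    unfolding cub_def case_prod_unfold A_def
    by (auto intro!: derivative_eq_intros simp: fun_eq_iff algebra_simps)
  then show "holo3 cub" by (rule holo3I)
  show "pdP cub 1 = (\<lambda>p. fst (snd p) * snd (snd p) + 2 * e1 * fst p + a)"
    "pdP cub 2 = (\<lambda>p. fst p * snd (snd p) + 2 * e2 * fst (snd p) + b)"
    "pdP cub 3 = (\<lambda>p. fst p * fst (snd p) - c)"
    using has_derivative_imp_pdP[OF deriv] by (auto simp: A_def)
qed

lemma holo3_pdP_cub: "holo3 (pdP cub 2)" "holo3 (pdP cub 3)"
proof -
  show "holo3 (pdP cub 2)"
    by (rule holo3I[where
          A = "\<lambda>k p. if k = 1 then snd (snd p) else if k = 2 then 2 * e2 else fst p"])
      (auto simp: pdP_cub fun_eq_iff algebra_simps intro!: derivative_eq_intros)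
  show "holo3 (pdP cub 3)"
    by (rule holo3I[where
          A = "\<lambda>k p. if k = 1 then fst (snd p) else if k = 2 then fst p else 0"])
      (auto simp: pdP_cub fun_eq_iff algebra_simps intro!: derivative_eq_intros)
qed

lemma not_hess_flat_12:
  assumes "c \<noteq> 0"
  shows "\<not> hess_flat cub 1 2"
proof
  assume flat: "hess_flat cub 1 2"
  let ?L = "\<lambda>w. fst w * snd w - c"
  have L: "has_d2 ?L (snd w) (fst w) w" for w
    by (rule has_d2_eq_rhs, (rule has_d2_intros)+) simp_all
  have L_holo: "holo2 ?L UNIV"
    using L by (rule holo2I[OF open_UNIV])
  have "(0, 0, d / c) \<in> pair_region cub 1 2"
    using assms by (simp add: pair_region_def surf_def pdP_cub) (simp add: cub_def)
  then have "mixed_log (\<lambda>w. (?L w)\<^sup>2) (0, 0) = 0"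
    using hess_flat_imp_mixed_log_zero[of 1 2 3 cub, OF _ holo3_cub holo3_pdP_cub(2) _ _ flat]
      holo2_mult[OF L_holo L_holo]
    by (fastforce simp: cyclic3_def pdP_cub power2_eq_square)
  moreover have "mixed_log ?L w = - c" for w
    using mixed_log_has_d2[OF L has_d2_snd] by simp
  ultimately show False
    using assms mixed_log_power2[OF L_holo UNIV_I] by simp
qed

text \<open>The discriminant of \<open>cub\<close> as a quadratic in its second variable. Its arguments are the
  third and the first variable, in this order, because (3, 1, 2) is a cyclic permutation.\<close>

definition disc :: "pt2 \<Rightarrow> complex" where
  "disc w = (fst w * snd w + b)\<^sup>2 - 4 * e2 * (e1 * (snd w)\<^sup>2 + a * snd w + d - c * fst w)"

lemma pdP_cub_2_square:
  assumes "p \<in> surf cub"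
  shows "(pdP cub 2 p)\<^sup>2 = disc (coord 3 p, coord 1 p)"
proof -
  have "(pdP cub 2 p)\<^sup>2 = disc (coord 3 p, coord 1 p) + 4 * e2 * cub p"
    unfolding pdP_cub disc_def
    by (simp add: cub_def case_prod_unfold power2_eq_square algebra_simps)
  then show ?thesis using assms by (simp add: surf_def)
qed

lemma has_d2_disc:
  "has_d2 disc (2 * snd w * (fst w * snd w + b) + 4 * e2 * c)
    (2 * fst w * (fst w * snd w + b) - 4 * e2 * (2 * e1 * snd w + a)) w"
  unfolding disc_def by (rule has_d2_eq_rhs, (rule has_d2_intros)+) (simp_all add: algebra_simps)

lemma mixed_log_disc:
  assumes "c = 0"
  shows "mixed_log disc (z, x) = 2 * b * (x * z + b)\<^sup>2 - 8 * e2 * (a * x + 2 * d) * (x * z + b)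
    + 8 * b * e2 * (e1 * x\<^sup>2 + a * x + d)"
proof -
  have "has_d2 (\<lambda>w. 2 * snd w * (fst w * snd w + b) + 4 * e2 * c)
      (2 * x\<^sup>2) (2 * (z * x + b) + 2 * x * z) (z, x)"
    by (rule has_d2_eq_rhs, (rule has_d2_intros)+) (simp_all add: algebra_simps power2_eq_square)
  from mixed_log_has_d2[OF has_d2_disc this] show ?thesis
    unfolding disc_def using assms by (simp add: power2_eq_square algebra_simps)
qed

lemma hess_flat_31_imp_mixed_log_disc_zero:
  assumes "c = 0" and flat: "hess_flat cub 3 1" and nz: "disc (z, x) \<noteq> 0"
    and root: "e2 * y\<^sup>2 + (x * z + b) * y + (e1 * x\<^sup>2 + a * x + d) = 0"
  shows "mixed_log disc (z, x) = 0"
proof -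
  have "(x, y, z) \<in> surf cub"
    using root \<open>c = 0\<close> unfolding surf_def cub_def by (simp add: algebra_simps)
  moreover from this have "pdP cub 2 (x, y, z) \<noteq> 0"
    using nz pdP_cub_2_square by fastforce
  ultimately have "(x, y, z) \<in> pair_region cub 3 1"
    by (simp add: pair_region_def)
  moreover have "cyclic3 3 1 2" by (simp add: cyclic3_def)
  moreover have "holo2 disc UNIV" using has_d2_disc by (rule holo2I[OF open_UNIV])
  ultimately show ?thesis
    using hess_flat_imp_mixed_log_zero[OF _ holo3_cub holo3_pdP_cub(1) _ pdP_cub_2_square flat]
    by fastforce
qed

lemma not_hess_flat_31:
  assumes "c = 0" and nz: "b \<noteq> 0 \<or> e2 \<noteq> 0 \<and> (a \<noteq> 0 \<or> d \<noteq> 0)"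
  shows "\<not> hess_flat cub 3 1"
proof
  assume flat: "hess_flat cub 3 1"
  obtain x where x: "x \<noteq> 0" "b \<noteq> 0 \<or> e2 * (a * x + 2 * d) \<noteq> 0"
  proof (cases "a + 2 * d = 0")
    case True
    then have "a = - 2 * d" by (simp add: eq_neg_iff_add_eq_0)
    then show ?thesis using nz by (intro that[of 2]) auto
  next
    case False
    then show ?thesis using nz by (intro that[of 1]) auto
  qed
  define D where "D = [:- 4 * e2 * (e1 * x\<^sup>2 + a * x + d), 0, 1:]"
  define K where "K = [:8 * b * e2 * (e1 * x\<^sup>2 + a * x + d), - 8 * e2 * (a * x + 2 * d), 2 * b:]"
  have "D * K \<noteq> 0" using x(2) by (auto simp: D_def K_def)
  then obtain u where u: "poly (D * K) u \<noteq> 0" using poly_all_0_iff_0 by blast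
  define z where "z = (u - b) / x"
  have xz: "x * z + b = u" using x(1) by (simp add: z_def)
  have disc: "disc (z, x) = poly D u" "u\<^sup>2 - 4 * e2 * (e1 * x\<^sup>2 + a * x + d) = poly D u"
    unfolding disc_def using xz \<open>c = 0\<close>
    by (simp_all add: D_def mult.commute power2_eq_square algebra_simps)
  have "e2 \<noteq> 0 \<or> u \<noteq> 0" using u disc(2) by auto
  then obtain y where "e2 * y\<^sup>2 + u * y + (e1 * x\<^sup>2 + a * x + d) = 0"
    by (rule complex_quadratic_root)
  then have "mixed_log disc (z, x) = 0"
    using hess_flat_31_imp_mixed_log_disc_zero[OF \<open>c = 0\<close> flat, of z x y] u disc(1) xz by simp
  then have "poly K u = 0"
    unfolding mixed_log_disc[OF \<open>c = 0\<close>] xz by (simp add: K_def power2_eq_square algebra_simps)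
  then show False using u by simp
qed

text \<open>The first and second partial derivatives of \<open>cub\<close>, multiplied by the third one to
  eliminate the third variable.\<close>

definition elim_pd1 :: "pt2 \<Rightarrow> complex" where
  "elim_pd1 w = e1 * (fst w)\<^sup>2 * snd w - 2 * c * e1 * fst w - a * c - e2 * (snd w)\<^sup>2 * snd w
    - b * (snd w)\<^sup>2 - d * snd w"

definition elim_pd2 :: "pt2 \<Rightarrow> complex" where
  "elim_pd2 w = e2 * fst w * (snd w)\<^sup>2 - 2 * c * e2 * snd w - b * c - e1 * (fst w)\<^sup>2 * fst w
    - a * (fst w)\<^sup>2 - d * fst w"

definition height :: "pt2 \<Rightarrow> complex" where
  "height w = - (e1 * (fst w)\<^sup>2 + e2 * (snd w)\<^sup>2 + a * fst w + b * snd w + d) / (fst w * snd w - c)"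

definition web_domain :: "pt2 set" where
  "web_domain = {w. fst w * snd w \<noteq> c \<and> elim_pd1 w \<noteq> 0 \<and> elim_pd2 w \<noteq> 0}"

lemma elim_pd_eq:
  "pdP cub 3 (x, y, z) * pdP cub 1 (x, y, z) = elim_pd1 (x, y) + y * cub (x, y, z)"
  "pdP cub 3 (x, y, z) * pdP cub 2 (x, y, z) = elim_pd2 (x, y) + x * cub (x, y, z)"
  unfolding pdP_cub elim_pd1_def elim_pd2_def
  by (simp_all add: cub_def power2_eq_square algebra_simps)

lemma web_region_cub: "web_region cub = graph3 height ` web_domain"
proof -
  have "(x, y, z) \<in> web_region cub \<longleftrightarrow> (x, y) \<in> web_domain \<and> z = height (x, y)" for x y z
  proof -
    have "cub (x, y, z) = 0 \<longleftrightarrow> z = height (x, y)" if "x * y \<noteq> c"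
      using that by (simp add: cub_def height_def field_simps)
    moreover have "pdP cub 3 (x, y, z) \<noteq> 0 \<longleftrightarrow> x * y \<noteq> c"
      by (simp add: pdP_cub)
    ultimately show ?thesis
      using elim_pd_eq[of x y z] by (auto simp: web_region_def surf_def web_domain_def)
  qed
  then show ?thesis by (force simp: graph3_def)
qed

lemma has_d2_elim_pd:
  "has_d2 elim_pd1 (2 * e1 * fst w * snd w - 2 * c * e1)
    (e1 * (fst w)\<^sup>2 - 3 * e2 * (snd w)\<^sup>2 - 2 * b * snd w - d) w"
  "has_d2 elim_pd2 (e2 * (snd w)\<^sup>2 - 3 * e1 * (fst w)\<^sup>2 - 2 * a * fst w - d)
    (2 * e2 * fst w * snd w - 2 * c * e2) w"
  unfolding elim_pd1_def elim_pd2_def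
  by (rule has_d2_eq_rhs, (rule has_d2_intros)+; simp add: power2_eq_square algebra_simps)+

lemma holo2_elim_pd: "holo2 elim_pd1 UNIV" "holo2 elim_pd2 UNIV"
  using holo2I[OF open_UNIV has_d2_elim_pd(1)] holo2I[OF open_UNIV has_d2_elim_pd(2)] .

lemma mixed_log_elim_pd:
  "mixed_log elim_pd1 w = elim_pd1 w * (2 * e1 * fst w)
    - (2 * e1 * fst w * snd w - 2 * c * e1)
      * (e1 * (fst w)\<^sup>2 - 3 * e2 * (snd w)\<^sup>2 - 2 * b * snd w - d)"
  "mixed_log elim_pd2 w = elim_pd2 w * (2 * e2 * snd w)
    - (e2 * (snd w)\<^sup>2 - 3 * e1 * (fst w)\<^sup>2 - 2 * a * fst w - d)
      * (2 * e2 * fst w * snd w - 2 * c * e2)"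
proof -
  have "has_d2 (\<lambda>w. 2 * e1 * fst w * snd w - 2 * c * e1) (2 * e1 * snd w) (2 * e1 * fst w) w"
    "has_d2 (\<lambda>w. e2 * (snd w)\<^sup>2 - 3 * e1 * (fst w)\<^sup>2 - 2 * a * fst w - d)
      (- 6 * e1 * fst w - 2 * a) (2 * e2 * snd w) w"
    by (rule has_d2_eq_rhs, (rule has_d2_intros)+; simp add: algebra_simps)+
  from mixed_log_has_d2[OF has_d2_elim_pd(1) this(1)] mixed_log_has_d2[OF has_d2_elim_pd(2) this(2)]
  show "mixed_log elim_pd1 w = elim_pd1 w * (2 * e1 * fst w)
      - (2 * e1 * fst w * snd w - 2 * c * e1)
      * (e1 * (fst w)\<^sup>2 - 3 * e2 * (snd w)\<^sup>2 - 2 * b * snd w - d)"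
    "mixed_log elim_pd2 w = elim_pd2 w * (2 * e2 * snd w)
      - (e2 * (snd w)\<^sup>2 - 3 * e1 * (fst w)\<^sup>2 - 2 * a * fst w - d)
      * (2 * e2 * fst w * snd w - 2 * c * e2)"
    by simp_all
qed

lemma web_parallelizable_imp_mixed_log_elim_pd:
  assumes web: "web_locally_parallelizable cub" and w: "w \<in> web_domain"
  shows "(elim_pd1 w)\<^sup>2 * mixed_log elim_pd2 w = (elim_pd2 w)\<^sup>2 * mixed_log elim_pd1 w"
proof -
  let ?W = "{w. elim_pd1 w \<noteq> 0}" and ?Q = "\<lambda>w. elim_pd2 w / elim_pd1 w"
  have N: "holo2 elim_pd1 ?W"
    using holo2_nonzero[OF holo2_elim_pd(1)] by simp
  have M: "holo2 elim_pd2 ?W"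
    by (rule holo2_subset[OF holo2_elim_pd(2) holo2_open[OF N]]) simp
  have "(coord 1 p, coord 2 p) \<in> ?W \<and> ?Q (coord 1 p, coord 2 p) = pdP cub 2 p / pdP cub 1 p"
    if "p \<in> web_region cub" for p
  proof -
    obtain x y z where p: "p = (x, y, z)" by (cases p)
    then have "cub (x, y, z) = 0" "pdP cub 1 p \<noteq> 0" "pdP cub 3 p \<noteq> 0"
      using that by (auto simp: web_region_def surf_def)
    moreover from this have "elim_pd1 (x, y) = pdP cub 3 p * pdP cub 1 p"
      "elim_pd2 (x, y) = pdP cub 3 p * pdP cub 2 p"
      using elim_pd_eq[of x y z] by (simp_all add: p)
    ultimately show ?thesis by (simp add: p)
  qed
  moreover have "graph3 height w \<in> web_region cub"
    using w by (simp add: web_region_cub)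
  moreover have "cyclic3 1 2 3" by (simp add: cyclic3_def)
  ultimately have "mixed_log ?Q (fst w, snd w) = 0"
    using web_parallelizable_imp_mixed_log_slope_zero[OF _ holo3_cub holo2_divide[OF M N] _ web]
    by (fastforce simp: graph3_def)
  then show ?thesis
    using w by (intro mixed_log_divide_zero_imp[OF M N]) (auto simp: web_domain_def)
qed

text \<open>The names refer to the line \<open>y = 1\<close>, on which the obstruction is a polynomial in one
  variable.\<close>

definition line_pd1 :: "complex poly" where
  "line_pd1 = [:- a * c - e2 - b - d, - 2 * c * e1, e1:]"

definition line_pd2 :: "complex poly" where
  "line_pd2 = [:- 2 * c * e2 - b * c, e2 - d, - a, - e1:]"

definition line_obstruction :: "complex poly" where
  "line_obstruction =
    line_pd1\<^sup>2 *
      [:- 2 * c * e2 * (e2 + b + d), - 4 * a * c * e2, 2 * a * e2 - 6 * c * e1 * e2, 4 * e1 * e2:]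
    - line_pd2\<^sup>2 *
      [:- 2 * c * e1 * (3 * e2 + 2 * b + d), 2 * e1 * (2 * e2 + b - a * c), - 2 * c * e1\<^sup>2:]"

lemma elim_pd_line: "elim_pd1 (x, 1) = poly line_pd1 x" "elim_pd2 (x, 1) = poly line_pd2 x"
  by (simp_all add: elim_pd1_def elim_pd2_def line_pd1_def line_pd2_def
      power2_eq_square algebra_simps)

lemma poly_line_obstruction:
  "poly line_obstruction x = (elim_pd1 (x, 1))\<^sup>2 * mixed_log elim_pd2 (x, 1)
    - (elim_pd2 (x, 1))\<^sup>2 * mixed_log elim_pd1 (x, 1)"
proof -
  have "mixed_log elim_pd1 (x, 1) =
      poly [:- 2 * c * e1 * (3 * e2 + 2 * b + d), 2 * e1 * (2 * e2 + b - a * c), - 2 * c * e1\<^sup>2:] x"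
    "mixed_log elim_pd2 (x, 1) =
      poly [:- 2 * c * e2 * (e2 + b + d), - 4 * a * c * e2,
        2 * a * e2 - 6 * c * e1 * e2, 4 * e1 * e2:] x"
    unfolding mixed_log_elim_pd elim_pd_line
    by (simp_all add: line_pd1_def line_pd2_def power2_eq_square algebra_simps)
  then show ?thesis
    by (simp only: elim_pd_line line_obstruction_def poly_diff poly_mult poly_power)
qed

lemma line_obstruction_nonzero:
  assumes "e1 \<noteq> 0" and nz: "c \<noteq> 0 \<or> b \<noteq> 0 \<or> e2 \<noteq> 0 \<and> (a \<noteq> 0 \<or> d \<noteq> 0)"
  shows "line_obstruction \<noteq> 0"
proof -
  note defs = line_obstruction_def line_pd1_def line_pd2_def
  note simps = power2_eq_square eval_nat_numeral One_nat_def algebra_simps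
  have "coeff line_obstruction 8 = 2 * c * e1 ^ 4"
    unfolding defs by (simp add: simps)
  moreover have "coeff line_obstruction 7 = - 2 * b * e1 ^ 3" if "c = 0"
    unfolding defs using that by (simp add: simps)
  moreover have "coeff line_obstruction 6 = - 6 * e2 * a * e1 ^ 2" if "c = 0" "b = 0"
    unfolding defs using that by (simp add: simps)
  moreover have "coeff line_obstruction 5 = - 16 * e2 * d * e1 ^ 2" if "c = 0" "b = 0" "a = 0"
    unfolding defs using that by (simp add: simps)
  ultimately show ?thesis
    using nz \<open>e1 \<noteq> 0\<close> by fastforce
qed

lemma web_not_parallelizable:
  assumes "e1 \<noteq> 0" and nz: "c \<noteq> 0 \<or> b \<noteq> 0 \<or> e2 \<noteq> 0 \<and> (a \<noteq> 0 \<or> d \<noteq> 0)"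
  shows "\<not> web_locally_parallelizable cub"
proof
  assume web: "web_locally_parallelizable cub"
  have "[:- c, 1:] * line_pd1 * line_pd2 * line_obstruction \<noteq> 0"
    using line_obstruction_nonzero[OF assms] \<open>e1 \<noteq> 0\<close>
    by (simp only: mult_eq_0_iff) (simp add: line_pd1_def line_pd2_def)
  then obtain x where x: "poly ([:- c, 1:] * line_pd1 * line_pd2 * line_obstruction) x \<noteq> 0"
    using poly_all_0_iff_0 by blast
  then have "(x, 1) \<in> web_domain"
    by (simp add: web_domain_def elim_pd_line)
  then have "poly line_obstruction x = 0"
    using web_parallelizable_imp_mixed_log_elim_pd[OF web] by (simp add: poly_line_obstruction)
  then show False using x by simp
qed

lemma has_d2_height:
  assumes "fst w * snd w \<noteq> c"
  shows "has_d2 height (- elim_pd1 w / (fst w * snd w - c)\<^sup>2)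
    (- elim_pd2 w / (fst w * snd w - c)\<^sup>2) w"
proof -
  let ?n = "\<lambda>w. - (e1 * (fst w)\<^sup>2 + e2 * (snd w)\<^sup>2 + a * fst w + b * snd w + d)"
  let ?m = "\<lambda>w. fst w * snd w - c"
  have n: "has_d2 ?n (- (2 * e1 * fst w + a)) (- (2 * e2 * snd w + b)) w"
    and m: "has_d2 ?m (snd w) (fst w) w"
    by (rule has_d2_eq_rhs, (rule has_d2_intros)+; simp)+
  have "- (2 * e1 * fst w + a) * ?m w - ?n w * snd w = - elim_pd1 w"
    "- (2 * e2 * snd w + b) * ?m w - ?n w * fst w = - elim_pd2 w"
    by (simp_all add: elim_pd1_def elim_pd2_def power2_eq_square algebra_simps)
  with has_d2_divide[OF n m] assms show ?thesis
    unfolding height_def by simp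
qed

lemma web_parallelizable:
  assumes "e1 = 0" "e2 = 0"
  shows "web_locally_parallelizable cub"
proof (rule graph_web_locally_parallelizable[OF web_region_cub])
  define r q where "r x = elim_pd2 (x, 0)" and "q y = elim_pd1 (0, y)" for x y
  have elim: "elim_pd2 w = r (fst w)" "elim_pd1 w = q (snd w)" for w
    unfolding r_def q_def elim_pd1_def elim_pd2_def using assms by simp_all
  show "r holomorphic_on UNIV" "q holomorphic_on UNIV"
    unfolding r_def q_def elim_pd1_def elim_pd2_def by (auto intro!: holomorphic_intros)
  have "open web_domain"
    unfolding web_domain_def Collect_conj_eq
    by (intro open_Int open_Collect_neq continuous_intros holo2_continuous_on holo2_elim_pd)
  then show "holo2 height web_domain"
    by (rule holo2I) (rule has_d2_height, simp add: web_domain_def)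
  fix w assume w: "w \<in> web_domain"
  then have "d2 1 height w = - q (snd w) / (fst w * snd w - c)\<^sup>2"
    "d2 2 height w = - r (fst w) / (fst w * snd w - c)\<^sup>2"
    using has_d2_height[THEN has_d2_imp_d2(1)] has_d2_height[THEN has_d2_imp_d2(2)]
    by (simp_all add: elim web_domain_def)
  then show "r (fst w) \<noteq> 0 \<and> q (snd w) \<noteq> 0 \<and> d2 1 height w \<noteq> 0"
    "d2 1 height w * r (fst w) = d2 2 height w * q (snd w)"
    using w by (simp_all add: elim web_domain_def)
qed

lemma not_hess_flat:
  assumes "c \<noteq> 0 \<or> b \<noteq> 0 \<or> e2 \<noteq> 0 \<and> (a \<noteq> 0 \<or> d \<noteq> 0)"
  shows "\<exists>i\<in>{1, 2, 3}. \<exists>j\<in>{1, 2, 3}. i \<noteq> j \<and> \<not> hess_flat cub i j"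
proof (cases "c = 0")
  case True
  then have "\<not> hess_flat cub 3 1" using not_hess_flat_31 assms by blast
  then show ?thesis by (intro bexI[of _ 3] bexI[of _ 1]) auto
next
  case False
  then have "\<not> hess_flat cub 1 2" by (rule not_hess_flat_12)
  then show ?thesis by (intro bexI[of _ 1] bexI[of _ 2]) auto
qed

end

lemma nonexc_cubicsE:
  assumes "P \<in> nonexc_cubics"
  obtains c e2 a b d where "P = cubic.cub c 1 e2 a b d" "c \<noteq> 0 \<or> b \<noteq> 0 \<or> e2 \<noteq> 0 \<and> (a \<noteq> 0 \<or> d \<noteq> 0)"
proof -
  have eqs:
    "(\<lambda>(x1,x2,x3). x1 * x2 * x3 + x1^2 + x2^2 - (s1 + s2 * s3)*x1
        - (s2 + s1 * s3)*x2 - s3 * x3 + (s3^2 + s1 * s2 * s3 + 1))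
      = cubic.cub s3 1 1 (- (s1 + s2 * s3)) (- (s2 + s1 * s3)) (s3\<^sup>2 + s1 * s2 * s3 + 1)"
    "(\<lambda>(x1,x2,x3). x1 * x2 * x3 + x1^2 + x2^2 + s1 * x1 + s2 * x2 + 1) = cubic.cub 0 1 1 s1 s2 1"
    "(\<lambda>(x1,x2,x3). x1 * x2 * x3 + x1^2 + x2^2 + (1 + \<alpha>*\<beta>)*x1 + (\<alpha> + \<beta>)*x2 + \<alpha>*\<beta>)
      = cubic.cub 0 1 1 (1 + \<alpha> * \<beta>) (\<alpha> + \<beta>) (\<alpha> * \<beta>)"
    "(\<lambda>(x1,x2,x3). x1 * x2 * x3 + x1^2 + x2^2 + \<alpha>*x1 + x2) = cubic.cub 0 1 1 \<alpha> 1 0"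
    "(\<lambda>(x1,x2,x3). x1 * x2 * x3 + x1^2 - x2^2 - x1) = cubic.cub 0 1 (- 1) (- 1) 0 0"
    "(\<lambda>(x1,x2,x3). x1 * x2 * x3 + x1^2 - (s2^2 + s1 * s2)*x1
        - s2^2 * x2 - s2^2 * x3 + (s2^2 + s1 * s2^3))
      = cubic.cub (s2\<^sup>2) 1 0 (- (s2\<^sup>2 + s1 * s2)) (- s2\<^sup>2) (s2\<^sup>2 + s1 * s2 ^ 3)"
    for s1 s2 s3 \<alpha> \<beta> :: complex
    by (auto simp: cubic.cub_def fun_eq_iff algebra_simps)
  consider
    (PV) s1 s2 s3 where "s3 \<noteq> 0"
      "P = cubic.cub s3 1 1 (- (s1 + s2 * s3)) (- (s2 + s1 * s3)) (s3\<^sup>2 + s1 * s2 * s3 + 1)"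
  | (PVdeg) s1 s2 where "P = cubic.cub 0 1 1 s1 s2 1"
  | (D6) \<alpha> \<beta> where "\<alpha> \<noteq> 0" "\<beta> \<noteq> 0" "P = cubic.cub 0 1 1 (1 + \<alpha> * \<beta>) (\<alpha> + \<beta>) (\<alpha> * \<beta>)"
  | (D7) \<alpha> where "P = cubic.cub 0 1 1 \<alpha> 1 0"
  | (D8) "P = cubic.cub 0 1 (- 1) (- 1) 0 0"
  | (PIV) s1 s2 where "s2 \<noteq> 0"
      "P = cubic.cub (s2\<^sup>2) 1 0 (- (s2\<^sup>2 + s1 * s2)) (- s2\<^sup>2) (s2\<^sup>2 + s1 * s2 ^ 3)"
    using assms unfolding nonexc_cubics_def eqs by blast
  then show thesis by cases (rule that, assumption, simp)+
qed

lemma exc_cubicsE: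
  assumes "P \<in> exc_cubics"
  obtains c a b d where "P = cubic.cub c 0 0 a b d" "c \<noteq> 0 \<or> b \<noteq> 0"
proof -
  have eqs:
    "(\<lambda>(x1,x2,x3). x1 * x2 * x3 + x1 - x2 + x3 + s) = cubic.cub (- 1) 0 0 1 (- 1) s"
    "(\<lambda>(x1,x2,x3). x1 * x2 * x3 - x1 - \<alpha>*x2 - x3 + \<alpha> + 1) = cubic.cub 1 0 0 (- 1) (- \<alpha>) (\<alpha> + 1)"
    "(\<lambda>(x1,x2,x3). x1 * x2 * x3 + x1 + x2 + 1) = cubic.cub 0 0 0 1 1 1" for s \<alpha> :: complex
    by (auto simp: cubic.cub_def fun_eq_iff algebra_simps)
  consider (FN) s where "P = cubic.cub (- 1) 0 0 1 (- 1) s"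
    | (PII) \<alpha> where "P = cubic.cub 1 0 0 (- 1) (- \<alpha>) (\<alpha> + 1)"
    | (PI) "P = cubic.cub 0 0 0 1 1 1"
    using assms unfolding exc_cubics_def eqs by blast
  then show thesis by cases (rule that, assumption, simp)+
qed

theorem theorem1p3:
  fixes P :: "complex \<times> complex \<times> complex \<Rightarrow> complex"
  assumes "P \<in> nonexc_cubics \<union> exc_cubics"
  shows "(P \<in> nonexc_cubics \<longrightarrow> \<not> web_locally_parallelizable P) \<and>
         (P \<in> exc_cubics \<longrightarrow> web_locally_parallelizable P) \<and>
         (\<exists>i\<in>{1,2,3::nat}. \<exists>j\<in>{1,2,3::nat}. i \<noteq> j \<and> \<not> hess_flat P i j)"
proof (intro conjI impI)
  show "\<not> web_locally_parallelizable P" if "P \<in> nonexc_cubics"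
    using nonexc_cubicsE[OF that] cubic.web_not_parallelizable by (metis one_neq_zero)
  show "web_locally_parallelizable P" if "P \<in> exc_cubics"
    using exc_cubicsE[OF that] cubic.web_parallelizable by metis
  from assms show "\<exists>i\<in>{1,2,3::nat}. \<exists>j\<in>{1,2,3::nat}. i \<noteq> j \<and> \<not> hess_flat P i j"
  proof
    assume "P \<in> nonexc_cubics"
    then show ?thesis by (elim nonexc_cubicsE) (simp only: cubic.not_hess_flat)
  next
    assume "P \<in> exc_cubics"
    then show ?thesis by (elim exc_cubicsE) (simp only: cubic.not_hess_flat simp_thms)
  qed
qed

end
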